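(* Let $\Lambda=\{(V_i,\Lambda_i,v_i)\}_{i\in I}$ be a $q$-$gf$-Riesz basis for $X$ with respect to $\{X_i\}_{i\in I}$ with bounds $A$ and $B$. Then $\Lambda$ is also a $g$-$p$-fusion frame for $X$ with respect to $\{X_i\}_{i\in I}$ with the same bounds $A$ and $B$.
   Context: $X$ is a separable Banach space over $\mathbb K$ ($\mathbb R$ or $\mathbb C$) with dual $X^*$; $1<p,q<\infty$ with $1/p+1/q=1$; $I\subset\mathbb N$; $X_i$ are Banach spaces over $\mathbb K$ with duals $X_i^*$; $V_i$ are closed subspaces of $X$; for each $i$ a non-trivial (nonzero) linear projection $P_{V_i}$ of $X$ onto $V_i$ is fixed as part of the data; $\Lambda_i\in\mathcal B(X,X_i)$ (bounded linear operators); $v_i>0$ are weights. The family $\Lambda=\{(V_i,\Lambda_i,v_i)\}_{i\in I}$ is a $g$-$p$-fusion frame for $X$ with respect to $\{X_i\}_{i\in I}$ with bounds $A,B$, where $0<A\le B<\infty$, if $A\|f\|\le\big(\sum_{i\in I}v_i^p\|\Lambda_iP_{V_i}(f)\|^p\big)^{1/p}\le B\|f\|$ for all $f\in X$. For $g_i\in X_i^*$, $P_{V_i}^*\Lambda_i^*g_i$ denotes the functional $f\mapsto g_i(\Lambda_iP_{V_i}f)$ on $X$. $\Lambda$ is a $q$-$gf$-Riesz basis for $X$ with respect to $\{X_i\}_{i\in I}$ with bounds $A,B$ if (a) $\{f\in X:\Lambda_iP_{V_i}(f)=0\ \forall i\in I\}=\{0\}$, and (b) $0<A\le B<\infty$ and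 for any finite subset $J\subset I$ and $g_i\in X_i^*$ ($i\in J$), $A(\sum_{i\in J}\|g_i\|^q)^{1/q}\le\|\sum_{i\in J}v_iP_{V_i}^*\Lambda_i^*g_i\|\le B(\sum_{i\in J}\|g_i\|^q)^{1/q}$, the middle norm being that of $X^*$. *)

theory Defs
  imports "HOL-Analysis.Analysis" "HOL-Algebra.Module"
begin

section \<open>Normed and Banach spaces over the real or complex numbers\<close>

text \<open>
  Normed spaces are HOL-Algebra modules with a norm, so that a family \<open>(Y i)\<close> of different spaces
  can be expressed as a function into one record type. As usual in HOL-Algebra, the fields
  \<^const>\<open>mult\<close> and \<^const>\<open>one\<close> of such a module are not used.
\<close>

record ('k, 'a) normed_module = "('k, 'a) Module.module" +
  nrm :: "'a \<Rightarrow> real"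

text \<open>
  The scalars are given by a set \<open>K\<close> of complex numbers, which is \<^term>\<open>\<real>\<close> or \<^term>\<open>UNIV\<close> below. The
  record serves both as the ring of scalars and as the one-dimensional normed space over it.
\<close>

definition scalar_field :: "complex set \<Rightarrow> (complex, complex) normed_module" where
  "scalar_field K =
     \<lparr>carrier = K, mult = (*), one = 1, zero = 0, add = (+), smult = (*), nrm = norm\<rparr>"

locale normed_space =
  fixes K :: "complex set" and X :: "(complex, 'a) normed_module" (structure)
  assumes vector_space: "Module.module (scalar_field K) X"
    and nrm_eq_zero: "x \<in> carrier X \<Longrightarrow> nrm X x = 0 \<longleftrightarrow> x = \<zero>"
    and nrm_triangle:
      "\<lbrakk>x \<in> carrier X; y \<in> carrier X\<rbrakk> \<Longrightarrow> nrm X (x \<oplus> y) \<le> nrm X x + nrm X y"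
    and nrm_smult:
      "\<lbrakk>c \<in> K; x \<in> carrier X\<rbrakk> \<Longrightarrow> nrm X (c \<odot>\<^bsub>X\<^esub> x) = norm c * nrm X x"

text \<open>
  The value \<open>0\<close> off the carrier is needed because \<^locale>\<open>Metric_space\<close> demands nonnegativity and
  symmetry on the whole type.
\<close>

definition nrm_dist :: "(complex, 'a) normed_module \<Rightarrow> 'a \<Rightarrow> 'a \<Rightarrow> real" where
  "nrm_dist X x y =
     (if x \<in> carrier X \<and> y \<in> carrier X then nrm X (x \<ominus>\<^bsub>X\<^esub> y) else 0)"

definition nrm_topology :: "(complex, 'a) normed_module \<Rightarrow> 'a topology" where
  "nrm_topology X = Metric_space.mtopology (carrier X) (nrm_dist X)"

lemma cring_scalar_field:
  assumes "K = \<real> \<or> K = UNIV"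
  shows "cring (scalar_field K)"
proof (rule cringI)
  have "\<And>x. x \<in> K \<Longrightarrow> \<exists>y\<in>K. y + x = 0"
    using assms by (metis UNIV_I Reals_minus ab_left_minus)
  then show "abelian_group (scalar_field K)"
    using assms by (intro abelian_groupI) (auto simp: scalar_field_def)
  show "comm_monoid (scalar_field K)"
    using assms by (intro comm_monoidI) (auto simp: scalar_field_def)
qed (auto simp: scalar_field_def distrib_right)

lemma normed_space_scalar_field:
  assumes "K = \<real> \<or> K = UNIV"
  shows "normed_space K (scalar_field K)"
proof (rule normed_space.intro)
  show "Module.module (scalar_field K) (scalar_field K)"
    using cring_scalar_field[OF assms] assms
    by (intro moduleI) (auto simp: cring_def ring_def scalar_field_def distrib_left distrib_right)
qed (auto simp: scalar_field_def norm_triangle_ineq norm_mult)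

context normed_space
begin

interpretation Module.module "scalar_field K" X
  by (rule vector_space)

lemma minus_one_smult: "- 1 \<in> K \<and> (\<forall>x\<in>carrier X. (- 1) \<odot>\<^bsub>X\<^esub> x = \<ominus> x)"
proof -
  have "\<ominus>\<^bsub>scalar_field K\<^esub> \<one>\<^bsub>scalar_field K\<^esub> \<oplus>\<^bsub>scalar_field K\<^esub> \<one>\<^bsub>scalar_field K\<^esub> = \<zero>\<^bsub>scalar_field K\<^esub>"
    by (rule R.l_neg) simp
  then have eq: "\<ominus>\<^bsub>scalar_field K\<^esub> \<one>\<^bsub>scalar_field K\<^esub> = - 1"
    by (simp add: scalar_field_def eq_neg_iff_add_eq_0)
  have "\<ominus>\<^bsub>scalar_field K\<^esub> \<one>\<^bsub>scalar_field K\<^esub> \<in> carrier (scalar_field K)"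
    by simp
  then have "- 1 \<in> K"
    unfolding eq by (simp add: scalar_field_def)
  moreover have "(- 1) \<odot>\<^bsub>X\<^esub> x = \<ominus> x" if "x \<in> carrier X" for x
    using smult_l_minus[OF R.one_closed that] smult_one[OF that] unfolding eq by simp
  ultimately show ?thesis by blast
qed

lemma nrm_minus: "x \<in> carrier X \<Longrightarrow> nrm X (\<ominus> x) = nrm X x"
  using minus_one_smult nrm_smult[of "- 1" x] by simp

lemma nrm_nonneg: "x \<in> carrier X \<Longrightarrow> 0 \<le> nrm X x"
  using nrm_triangle[of x "\<ominus> x"] nrm_minus[of x] nrm_eq_zero[of \<zero>] by (simp add: M.r_neg)

lemma Metric_space_nrm_dist: "Metric_space (carrier X) (nrm_dist X)"
proof
  show "0 \<le> nrm_dist X x y" for x y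
    by (simp add: nrm_dist_def nrm_nonneg)
  show "nrm_dist X x y = nrm_dist X y x" for x y
  proof (cases "x \<in> carrier X \<and> y \<in> carrier X")
    case True
    then have "\<ominus> (x \<ominus> y) = y \<ominus> x"
      by (simp add: M.minus_eq M.minus_add M.a_comm)
    with True show ?thesis
      using nrm_minus[of "x \<ominus> y"] by (simp add: nrm_dist_def)
  qed (auto simp: nrm_dist_def)
  show "nrm_dist X x y = 0 \<longleftrightarrow> x = y" if "x \<in> carrier X" "y \<in> carrier X" for x y
  proof -
    have "x \<ominus> y = \<zero> \<Longrightarrow> x = y"
      using that M.minus_equality[of x "\<ominus> y"] by (simp add: M.minus_eq)
    moreover have "y \<ominus> y = \<zero>"
      using that by (simp add: M.minus_eq M.r_neg)
    ultimately show ?thesis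
      using that by (auto simp: nrm_dist_def nrm_eq_zero)
  qed
  show "nrm_dist X x z \<le> nrm_dist X x y + nrm_dist X y z"
    if "x \<in> carrier X" "y \<in> carrier X" "z \<in> carrier X" for x y z
  proof -
    have "x \<ominus> z = (x \<ominus> y) \<oplus> (y \<ominus> z)"
      using that by (simp add: M.minus_eq M.a_assoc) (metis M.a_assoc M.a_inv_closed M.l_neg M.l_zero)
    then show ?thesis
      using that nrm_triangle[of "x \<ominus> y" "y \<ominus> z"] by (simp add: nrm_dist_def)
  qed
qed

end

locale banach_space = normed_space +
  assumes complete: "Metric_space.mcomplete (carrier X) (nrm_dist X)"

definition linear_map ::
  "complex set \<Rightarrow> (complex, 'a) normed_module \<Rightarrow> (complex, 'b) normed_module \<Rightarrow> ('a \<Rightarrow> 'b) \<Rightarrow> bool"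
  where
  "linear_map K X Y T \<longleftrightarrow>
     T \<in> carrier X \<rightarrow> carrier Y \<and>
     (\<forall>x\<in>carrier X. \<forall>y\<in>carrier X. T (x \<oplus>\<^bsub>X\<^esub> y) = T x \<oplus>\<^bsub>Y\<^esub> T y) \<and>
     (\<forall>c\<in>K. \<forall>x\<in>carrier X. T (c \<odot>\<^bsub>X\<^esub> x) = c \<odot>\<^bsub>Y\<^esub> T x)"

definition bounded_operators ::
  "complex set \<Rightarrow> (complex, 'a) normed_module \<Rightarrow> (complex, 'b) normed_module \<Rightarrow> ('a \<Rightarrow> 'b) set"
  where
  "bounded_operators K X Y =
     {T. linear_map K X Y T \<and> (\<exists>C. \<forall>x\<in>carrier X. nrm Y (T x) \<le> C * nrm X x)}"

definition dual :: "complex set \<Rightarrow> (complex, 'a) normed_module \<Rightarrow> ('a \<Rightarrow> complex) set" where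
  "dual K X = bounded_operators K X (scalar_field K)"

definition dual_norm :: "(complex, 'a) normed_module \<Rightarrow> ('a \<Rightarrow> complex) \<Rightarrow> real" where
  "dual_norm X g = (SUP x\<in>{x \<in> carrier X. nrm X x \<le> 1}. norm (g x))"

section \<open>\<open>g\<close>-\<open>p\<close>-fusion frames and \<open>q\<close>-\<open>gf\<close>-Riesz bases\<close>

text \<open>Projections are not required to be bounded.\<close>

definition linear_projection ::
  "complex set \<Rightarrow> (complex, 'a) normed_module \<Rightarrow> 'a set \<Rightarrow> ('a \<Rightarrow> 'a) \<Rightarrow> bool" where
  "linear_projection K X V P \<longleftrightarrow>
     linear_map K X X P \<and> P ` carrier X = V \<and> (\<forall>x\<in>carrier X. P (P x) = P x)"

definition fusion_family ::
  "complex set \<Rightarrow> nat set \<Rightarrow> (complex, 'a) normed_module \<Rightarrow> (nat \<Rightarrow> (complex, 'b) normed_module)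
    \<Rightarrow> (nat \<Rightarrow> 'a set) \<Rightarrow> (nat \<Rightarrow> 'a \<Rightarrow> 'a) \<Rightarrow> (nat \<Rightarrow> 'a \<Rightarrow> 'b) \<Rightarrow> (nat \<Rightarrow> real) \<Rightarrow> bool"
  where
  "fusion_family K I X Y V P L v \<longleftrightarrow>
     (\<forall>i\<in>I. submodule (V i) (scalar_field K) X \<and> closedin (nrm_topology X) (V i) \<and>
        linear_projection K X (V i) (P i) \<and> (\<exists>x\<in>carrier X. P i x \<noteq> \<zero>\<^bsub>X\<^esub>) \<and>
        L i \<in> bounded_operators K X (Y i) \<and> 0 < v i)"

definition g_fusion_frame ::
  "real \<Rightarrow> complex set \<Rightarrow> nat set \<Rightarrow> (complex, 'a) normed_module
    \<Rightarrow> (nat \<Rightarrow> (complex, 'b) normed_module)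
    \<Rightarrow> (nat \<Rightarrow> 'a set) \<Rightarrow> (nat \<Rightarrow> 'a \<Rightarrow> 'a) \<Rightarrow> (nat \<Rightarrow> 'a \<Rightarrow> 'b) \<Rightarrow> (nat \<Rightarrow> real)
    \<Rightarrow> real \<Rightarrow> real \<Rightarrow> bool"
  where
  "g_fusion_frame p K I X Y V P L v A B \<longleftrightarrow>
     fusion_family K I X Y V P L v \<and> 0 < A \<and> A \<le> B \<and>
     (\<forall>f\<in>carrier X.
        (\<lambda>i. v i powr p * nrm (Y i) (L i (P i f)) powr p) summable_on I \<and>
        A * nrm X f \<le> (\<Sum>\<^sub>\<infinity>i\<in>I. v i powr p * nrm (Y i) (L i (P i f)) powr p) powr (1 / p) \<and>
        (\<Sum>\<^sub>\<infinity>i\<in>I. v i powr p * nrm (Y i) (L i (P i f)) powr p) powr (1 / p) \<le> B * nrm X f)"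

text \<open>
  The functional \<open>\<Sum>i\<in>J. v\<^sub>i P\<^sub>i\<^sup>* L\<^sub>i\<^sup>* g\<^sub>i\<close> is written out. Since its norm in the dual
  of \<open>X\<close> is taken and the projections may be unbounded, its membership in the dual is part of the
  definition; the supremum in \<^const>\<open>dual_norm\<close> is meaningful only then.
\<close>

definition gf_riesz_basis ::
  "real \<Rightarrow> complex set \<Rightarrow> nat set \<Rightarrow> (complex, 'a) normed_module
    \<Rightarrow> (nat \<Rightarrow> (complex, 'b) normed_module)
    \<Rightarrow> (nat \<Rightarrow> 'a set) \<Rightarrow> (nat \<Rightarrow> 'a \<Rightarrow> 'a) \<Rightarrow> (nat \<Rightarrow> 'a \<Rightarrow> 'b) \<Rightarrow> (nat \<Rightarrow> real)
    \<Rightarrow> real \<Rightarrow> real \<Rightarrow> bool"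
  where
  "gf_riesz_basis q K I X Y V P L v A B \<longleftrightarrow>
     fusion_family K I X Y V P L v \<and>
     {f \<in> carrier X. \<forall>i\<in>I. L i (P i f) = \<zero>\<^bsub>Y i\<^esub>} = {\<zero>\<^bsub>X\<^esub>} \<and>
     0 < A \<and> A \<le> B \<and>
     (\<forall>J g. finite J \<and> J \<subseteq> I \<and> (\<forall>i\<in>J. g i \<in> dual K (Y i)) \<longrightarrow>
        (\<lambda>f. \<Sum>i\<in>J. of_real (v i) * g i (L i (P i f))) \<in> dual K X \<and>
        A * (\<Sum>i\<in>J. dual_norm (Y i) (g i) powr q) powr (1 / q)
          \<le> dual_norm X (\<lambda>f. \<Sum>i\<in>J. of_real (v i) * g i (L i (P i f))) \<and>
        dual_norm X (\<lambda>f. \<Sum>i\<in>J. of_real (v i) * g i (L i (P i f)))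
          \<le> B * (\<Sum>i\<in>J. dual_norm (Y i) (g i) powr q) powr (1 / q))"

end

theory Submission
  imports Defs
begin

text \<open>
  Let \<open>U f = (v\<^sub>i \<Lambda>\<^sub>i P\<^sub>i f)\<^sub>i\<close> be the analysis operator, with values in the \<open>\<ell>\<^sup>p\<close> sum of the spaces \<open>X\<^sub>i\<close>. The
  frame inequalities say \<open>A * \<parallel>f\<parallel> \<le> \<parallel>U f\<parallel> \<le> B * \<parallel>f\<parallel>\<close>, and the Riesz inequalities say the same of its
  adjoint on finitely supported families of functionals.

  The upper bound passes from the adjoint to \<open>U\<close> by testing with norming functionals
  (\<open>analysis_upper\<close>). For the lower bound, an adjoint that is bounded below by \<open>A\<close> makes \<open>U\<close> surjective,
  with preimages of \<open>y\<close> of norm at most about \<open>\<parallel>y\<parallel> / A\<close>; as \<open>U\<close> is also injective by the completeness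
  condition, the preimage of \<open>U x\<close> is \<open>x\<close> itself, and \<open>\<parallel>x\<parallel> \<le> \<parallel>U x\<parallel> / A\<close> follows.

  Approximate preimages are found without separating convex sets. For \<open>c \<ge> 0\<close> consider the
  seminorm \<open>N y = inf\<^sub>f (\<parallel>f\<parallel> + c * \<parallel>y - U f\<parallel>)\<close>. By the Hahn-Banach theorem there is a functional \<open>\<phi>\<close> with
  \<open>\<bar>\<phi>\<bar> \<le> N\<close> and \<open>\<phi> y = N y\<close>. Since \<open>N (U f) \<le> \<parallel>f\<parallel>\<close>, the functional \<open>\<phi> \<circ> U\<close> has norm at most \<open>1\<close>, so the lower
  Riesz bound gives \<open>\<parallel>\<phi>\<parallel> \<le> 1 / A\<close> (\<open>functional_bound\<close>) and thus \<open>N y \<le> \<parallel>y\<parallel> / A\<close> for every \<open>c\<close>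
  (\<open>approx_norm_bound\<close>). Successive approximation in the complete space \<open>X\<close> turns this
  into the lower bound (\<open>bounded_below_if_approx\<close>).

  The Hahn-Banach theorem is proved below for seminorms on modules over the real or complex
  numbers, by showing that minimal sublinear functionals are linear.
\<close>

section \<open>The Hahn-Banach theorem\<close>

text \<open>
  The scalars are all of \<open>\<real>\<close> or \<open>\<complex>\<close>, so every real multiple makes sense; no norm is involved yet
  because the Hahn-Banach theorem is applied to a seminorm that differs from the norm of the space.
\<close>

locale scalar_module = Module.module "scalar_field K" X
  for K :: "complex set" and X :: "(complex, 'a) normed_module" (structure) +
  assumes K_cases: "K = \<real> \<or> K = UNIV"
begin

lemma of_real_K [simp]: "complex_of_real t \<in> K"
  using K_cases by auto

lemma K_smult:
  assumes "x \<in> carrier X"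
  shows "c \<in> K \<Longrightarrow> c \<odot>\<^bsub>X\<^esub> x \<in> carrier X"
    and "\<lbrakk>c \<in> K; d \<in> K\<rbrakk> \<Longrightarrow> (c + d) \<odot>\<^bsub>X\<^esub> x = c \<odot>\<^bsub>X\<^esub> x \<oplus> d \<odot>\<^bsub>X\<^esub> x"
    and "\<lbrakk>c \<in> K; d \<in> K\<rbrakk> \<Longrightarrow> (c * d) \<odot>\<^bsub>X\<^esub> x = c \<odot>\<^bsub>X\<^esub> (d \<odot>\<^bsub>X\<^esub> x)"
    and "1 \<odot>\<^bsub>X\<^esub> x = x"
    and "0 \<odot>\<^bsub>X\<^esub> x = \<zero>"
  using assms smult_closed[of c x] smult_l_distr[of c d x] smult_assoc1[of c d x] smult_one[of x]
    smult_l_null[of x]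
  by (simp_all add: scalar_field_def)

lemma K_smult_add:
  "\<lbrakk>c \<in> K; x \<in> carrier X; y \<in> carrier X\<rbrakk> \<Longrightarrow> c \<odot>\<^bsub>X\<^esub> (x \<oplus> y) = c \<odot>\<^bsub>X\<^esub> x \<oplus> c \<odot>\<^bsub>X\<^esub> y"
  using smult_r_distr[of c x y] by (simp add: scalar_field_def)

lemma K_smult_zero: "c \<in> K \<Longrightarrow> c \<odot>\<^bsub>X\<^esub> \<zero> = \<zero>"
  using smult_r_null[of c] by (simp add: scalar_field_def)

lemma minus_one_K [simp]: "- 1 \<in> K"
  using of_real_K[of "-1"] by simp

lemma K_minus_one: 
  assumes "x \<in> carrier X" shows "(- 1) \<odot>\<^bsub>X\<^esub> x = \<ominus> x"
proof -
  have "(- 1) \<odot>\<^bsub>X\<^esub> x \<oplus> x = (- 1 + 1) \<odot>\<^bsub>X\<^esub> x"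
    using K_smult(2)[OF assms, of "-1" 1] of_real_K[of 1] by (simp add: K_smult(4)[OF assms])
  then have "(- 1) \<odot>\<^bsub>X\<^esub> x \<oplus> x = \<zero>"
    by (simp add: K_smult assms)
  then show ?thesis
    using M.minus_equality[of "(- 1) \<odot>\<^bsub>X\<^esub> x" x] assms by (simp add: K_smult)
qed

text \<open>
  Only the inequality is required for positive multiples: the equality follows by rescaling with
  the inverse factor, and inequalities pass easily to the infima taken below.
\<close>

definition sublinear :: "('a \<Rightarrow> real) \<Rightarrow> bool" where
  "sublinear r \<longleftrightarrow> (\<forall>x\<in>carrier X. \<forall>y\<in>carrier X. r (x \<oplus> y) \<le> r x + r y) \<and>
     (\<forall>t>0. \<forall>x\<in>carrier X. r (of_real t \<odot>\<^bsub>X\<^esub> x) \<le> t * r x)"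

lemma sublinear_add: "\<lbrakk>sublinear r; x \<in> carrier X; y \<in> carrier X\<rbrakk> \<Longrightarrow> r (x \<oplus> y) \<le> r x + r y"
  by (simp add: sublinear_def)

lemma sublinear_smult_le:
  "\<lbrakk>sublinear r; 0 < t; x \<in> carrier X\<rbrakk> \<Longrightarrow> r (of_real t \<odot>\<^bsub>X\<^esub> x) \<le> t * r x"
  by (simp add: sublinear_def)

lemma real_smult_assoc:
  "x \<in> carrier X \<Longrightarrow> of_real s \<odot>\<^bsub>X\<^esub> (of_real t \<odot>\<^bsub>X\<^esub> x) = of_real (s * t) \<odot>\<^bsub>X\<^esub> x"
  by (simp add: K_smult)

lemma sublinear_smult:
  assumes r: "sublinear r" and t: "0 < t" and x: "x \<in> carrier X"
  shows "r (of_real t \<odot>\<^bsub>X\<^esub> x) = t * r x"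
proof (rule antisym)
  have "r (of_real (1 / t) \<odot>\<^bsub>X\<^esub> (of_real t \<odot>\<^bsub>X\<^esub> x)) \<le> (1 / t) * r (of_real t \<odot>\<^bsub>X\<^esub> x)"
    using r t x by (intro sublinear_smult_le) (auto simp: K_smult)
  then show "t * r x \<le> r (of_real t \<odot>\<^bsub>X\<^esub> x)"
    using t x by (simp only: real_smult_assoc) (simp add: K_smult field_simps)
qed (use assms in \<open>simp add: sublinear_smult_le\<close>)

lemma sublinear_zero:
  assumes "sublinear r" shows "r \<zero> = 0"
  using sublinear_smult[OF assms, of 2 \<zero>] K_smult_zero[of 2] of_real_K[of 2] by simp

lemma sublinear_minus:
  assumes "sublinear r" "x \<in> carrier X" shows "- r x \<le> r (\<ominus> x)"
  using sublinear_add[OF assms, of "\<ominus> x"] assms sublinear_zero[of r] by (simp add: M.r_neg)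

text \<open>
  The largest sublinear minorant of \<open>r\<close> that is additive in the direction \<open>a\<close>, in the sense that its
  value at \<open>- a\<close> is at most \<open>- r a\<close>. A minimal sublinear functional equals all its minorants of
  this kind, which makes it linear.
\<close>

definition lower :: "('a \<Rightarrow> real) \<Rightarrow> 'a \<Rightarrow> 'a \<Rightarrow> real" where
  "lower r a x = (if x \<in> carrier X
     then INF t\<in>{0..}. r (x \<oplus> of_real t \<odot>\<^bsub>X\<^esub> a) - t * r a else 0)"

lemma
  assumes r: "sublinear r" and a: "a \<in> carrier X" and x: "x \<in> carrier X"
  shows lower_le_shift: "0 \<le> t \<Longrightarrow> lower r a x \<le> r (x \<oplus> of_real t \<odot>\<^bsub>X\<^esub> a) - t * r a"
    and le_lower: "(\<And>t. 0 \<le> t \<Longrightarrow> z \<le> r (x \<oplus> of_real t \<odot>\<^bsub>X\<^esub> a) - t * r a) \<Longrightarrow> z \<le> lower r a x"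
proof -
  have "- r (\<ominus> x) \<le> r (x \<oplus> of_real t \<odot>\<^bsub>X\<^esub> a) - t * r a" if "0 \<le> t" for t
  proof -
    let ?b = "of_real t \<odot>\<^bsub>X\<^esub> a"
    have "r ?b = t * r a"
      using that r a sublinear_smult[of r t a] by (cases "t = 0") (auto simp: K_smult sublinear_zero)
    moreover have "\<ominus> x \<oplus> (x \<oplus> ?b) = ?b"
      using a x by (simp add: K_smult M.a_assoc[symmetric] M.l_neg)
    ultimately show ?thesis
      using sublinear_add[OF r, of "\<ominus> x" "x \<oplus> ?b"] a x by (simp add: K_smult)
  qed
  then have bdd: "bdd_below ((\<lambda>t. r (x \<oplus> of_real t \<odot>\<^bsub>X\<^esub> a) - t * r a) ` {0..})"
    by (intro bdd_belowI2[where m="- r (\<ominus> x)"]) auto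
  show "0 \<le> t \<Longrightarrow> lower r a x \<le> r (x \<oplus> of_real t \<odot>\<^bsub>X\<^esub> a) - t * r a"
    using x cINF_lower[OF bdd, of t] by (simp add: lower_def)
  show "(\<And>t. 0 \<le> t \<Longrightarrow> z \<le> r (x \<oplus> of_real t \<odot>\<^bsub>X\<^esub> a) - t * r a) \<Longrightarrow> z \<le> lower r a x"
    using x by (auto simp: lower_def intro!: cINF_greatest)
qed

lemma lower_le: "\<lbrakk>sublinear r; a \<in> carrier X; x \<in> carrier X\<rbrakk> \<Longrightarrow> lower r a x \<le> r x"
  using lower_le_shift[of r a x 0] by (simp add: K_smult)

lemma lower_minus: "\<lbrakk>sublinear r; a \<in> carrier X\<rbrakk> \<Longrightarrow> lower r a (\<ominus> a) \<le> - r a"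
  using lower_le_shift[of r a "\<ominus> a" 1] sublinear_zero[of r] by (simp add: K_smult M.l_neg)

lemma sublinear_lower:
  assumes r: "sublinear r" and a: "a \<in> carrier X"
  shows "sublinear (lower r a)"
  unfolding sublinear_def
proof (intro conjI ballI allI impI)
  fix x y assume x: "x \<in> carrier X" and y: "y \<in> carrier X"
  have "lower r a (x \<oplus> y) \<le> (r (x \<oplus> of_real t \<odot>\<^bsub>X\<^esub> a) - t * r a) + (r (y \<oplus> of_real s \<odot>\<^bsub>X\<^esub> a) - s * r a)"
    if "0 \<le> t" "0 \<le> s" for s t
  proof -
    have "(x \<oplus> y) \<oplus> of_real (t + s) \<odot>\<^bsub>X\<^esub> a = (x \<oplus> of_real t \<odot>\<^bsub>X\<^esub> a) \<oplus> (y \<oplus> of_real s \<odot>\<^bsub>X\<^esub> a)"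
      using x y a K_smult(2)[OF a, of "of_real t" "of_real s"] by (simp add: K_smult(1) M.a_ac)
    then show ?thesis
      using lower_le_shift[OF r a, of "x \<oplus> y" "t + s"] that x y a
        sublinear_add[OF r, of "x \<oplus> of_real t \<odot>\<^bsub>X\<^esub> a" "y \<oplus> of_real s \<odot>\<^bsub>X\<^esub> a"]
      by (simp add: K_smult(1) algebra_simps del: of_real_add)
  qed
  then have "lower r a (x \<oplus> y) - (r (x \<oplus> of_real t \<odot>\<^bsub>X\<^esub> a) - t * r a) \<le> lower r a y" if "0 \<le> t" for t
    using that by (intro le_lower[OF r a y]) (smt (verit))
  then have "lower r a (x \<oplus> y) - lower r a y \<le> lower r a x"
    by (intro le_lower[OF r a x]) (smt (verit))
  then show "lower r a (x \<oplus> y) \<le> lower r a x + lower r a y" by simp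
next
  fix t x assume t: "(0::real) < t" and x: "x \<in> carrier X"
  have "lower r a (of_real t \<odot>\<^bsub>X\<^esub> x) / t \<le> r (x \<oplus> of_real s \<odot>\<^bsub>X\<^esub> a) - s * r a" if "0 \<le> s" for s
  proof -
    have "of_real t \<odot>\<^bsub>X\<^esub> x \<oplus> of_real (t * s) \<odot>\<^bsub>X\<^esub> a = of_real t \<odot>\<^bsub>X\<^esub> (x \<oplus> of_real s \<odot>\<^bsub>X\<^esub> a)"
      using x a by (simp only: K_smult_add[OF of_real_K x K_smult(1)[OF a of_real_K]] real_smult_assoc)
    then have "lower r a (of_real t \<odot>\<^bsub>X\<^esub> x) \<le> t * r (x \<oplus> of_real s \<odot>\<^bsub>X\<^esub> a) - (t * s) * r a"
      using lower_le_shift[OF r a, of "of_real t \<odot>\<^bsub>X\<^esub> x" "t * s"] t that x a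
        sublinear_smult[OF r t, of "x \<oplus> of_real s \<odot>\<^bsub>X\<^esub> a"]
      by (simp add: K_smult(1) del: of_real_mult)
    with t show ?thesis by (simp add: field_simps)
  qed
  then have "lower r a (of_real t \<odot>\<^bsub>X\<^esub> x) / t \<le> lower r a x"
    by (rule le_lower[OF r a x])
  with t show "lower r a (of_real t \<odot>\<^bsub>X\<^esub> x) \<le> t * lower r a x"
    by (simp add: field_simps)
qed

text \<open>
  Zorn's lemma on whole-space sublinear functionals ordered pointwise replaces the extension of
  functionals from subspaces. The infimum of a chain is finite since each of its members is at
  least \<open>- N (- x)\<close> at \<open>x\<close>, and it is subadditive since any two members are comparable.
\<close>

lemma minimal_sublinear:
  assumes N: "sublinear N"
  obtains m where "sublinear m" "\<And>x. x \<in> carrier X \<Longrightarrow> m x \<le> N x"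
    "\<And>r x. \<lbrakk>sublinear r; \<And>y. y \<in> carrier X \<Longrightarrow> r y \<le> m y; x \<in> carrier X\<rbrakk> \<Longrightarrow> r x = m x"
proof -
  \<comment> \<open>With the value \<open>0\<close> fixed off the carrier, the pointwise order of total functions compares the
    values on the carrier only.\<close>
  define S where "S = {r. sublinear r \<and> (\<forall>x. x \<notin> carrier X \<longrightarrow> r x = 0) \<and> (\<forall>x\<in>carrier X. r x \<le> N x)}"
  define ext where "ext r = (\<lambda>x. if x \<in> carrier X then r x else 0)" for r :: "'a \<Rightarrow> real"
  have ext: "sublinear (ext r) \<longleftrightarrow> sublinear r" for r
    by (simp add: ext_def sublinear_def K_smult)
  have "\<exists>m\<in>S. \<forall>r\<in>S. r \<le> m \<longrightarrow> r = m"
  proof (rule predicate_Zorn)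
    show "partial_order_on S (relation_of (\<lambda>r s. s \<le> r) S)"
      by (rule partial_order_on_relation_ofI) auto
    fix C assume "C \<in> Chains (relation_of (\<lambda>r s. s \<le> r) S)"
    then have C: "C \<subseteq> S" and chain: "\<And>r s. \<lbrakk>r \<in> C; s \<in> C\<rbrakk> \<Longrightarrow> r \<le> s \<or> s \<le> r"
      by (auto simp: Chains_def relation_of_def)
    show "\<exists>u\<in>S. \<forall>a\<in>C. u \<le> a"
    proof (cases "C = {}")
      case True
      have "ext N \<in> S" using N ext by (auto simp: S_def) (auto simp: ext_def)
      with True show ?thesis by blast
    next
      case False
      define u where "u x = (INF r\<in>C. r x)" for x
      have bdd: "bdd_below ((\<lambda>r. r x) ` C)" for x
      proof (cases "x \<in> carrier X")
        case True
        have "- N (\<ominus> x) \<le> r x" if "r \<in> C" for r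
        proof -
          have "r (\<ominus> x) \<le> N (\<ominus> x)" "sublinear r" using C that True by (auto simp: S_def)
          with sublinear_minus[of r "\<ominus> x"] True show ?thesis by (simp)
        qed
        then show ?thesis by (intro bdd_belowI2)
      next
        case False
        with C show ?thesis by (intro bdd_belowI2[where m=0]) (auto simp: S_def)
      qed
      have le: "u x \<le> r x" if "r \<in> C" for r x
        unfolding u_def by (rule cINF_lower[OF bdd that])
      have ge: "z \<le> u x" if "\<And>r. r \<in> C \<Longrightarrow> z \<le> r x" for z x
        unfolding u_def by (rule cINF_greatest[OF False that])
      have "sublinear u"
        unfolding sublinear_def
      proof (intro conjI ballI allI impI)
        fix x y assume x: "x \<in> carrier X" and y: "y \<in> carrier X"
        have "u (x \<oplus> y) \<le> r x + s y" if rs: "r \<in> C" "s \<in> C" for r s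
        proof -
          have 1: "r (x \<oplus> y) \<le> r x + r y" "s (x \<oplus> y) \<le> s x + s y"
            using rs C x y by (auto simp: S_def sublinear_def)
          consider "r y \<le> s y" | "s x \<le> r x"
            using chain[OF rs] by (auto simp: le_fun_def)
          then show ?thesis
            using le[OF rs(1), of "x \<oplus> y"] le[OF rs(2), of "x \<oplus> y"] 1 by cases auto
        qed
        then have "u (x \<oplus> y) - r x \<le> u y" if "r \<in> C" for r
          using that by (intro ge) (smt (verit))
        then have "u (x \<oplus> y) - u y \<le> u x" by (intro ge) (smt (verit))
        then show "u (x \<oplus> y) \<le> u x + u y" by simp
      next
        fix t x assume t: "(0::real) < t" and x: "x \<in> carrier X"
        have "u (of_real t \<odot>\<^bsub>X\<^esub> x) / t \<le> r x" if "r \<in> C" for r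
        proof -
          have "sublinear r" using C that by (auto simp: S_def)
          from sublinear_smult[OF this t x] le[OF that, of "of_real t \<odot>\<^bsub>X\<^esub> x"] t
          show ?thesis by (simp add: field_simps)
        qed
        then have "u (of_real t \<odot>\<^bsub>X\<^esub> x) / t \<le> u x" by (rule ge)
        with t show "u (of_real t \<odot>\<^bsub>X\<^esub> x) \<le> t * u x" by (simp add: field_simps)
      qed
      moreover have "u x = 0" if "x \<notin> carrier X" for x
      proof -
        have "(\<lambda>r. r x) ` C = (\<lambda>r. 0) ` C" using C that by (intro image_cong) (auto simp: S_def)
        with False show ?thesis by (simp add: u_def)
      qed
      moreover have "u x \<le> N x" if "x \<in> carrier X" for x
      proof -
        obtain r where "r \<in> C" using False by blast
        with le[OF this, of x] C that show ?thesis by (fastforce simp: S_def)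
      qed
      ultimately have "u \<in> S" by (simp add: S_def)
      with le show ?thesis by (auto simp: le_fun_def)
    qed
  qed
  then obtain m where m: "m \<in> S" and min: "\<And>r. r \<in> S \<Longrightarrow> r \<le> m \<Longrightarrow> r = m" by blast
  show thesis
  proof
    show "sublinear m" "\<And>x. x \<in> carrier X \<Longrightarrow> m x \<le> N x" using m by (auto simp: S_def)
    fix r x assume r: "sublinear r" "\<And>y. y \<in> carrier X \<Longrightarrow> r y \<le> m y" and x: "x \<in> carrier X"
    have "ext r \<in> S" "ext r \<le> m"
      using r m ext[of r] by (force simp: S_def ext_def le_fun_def)+
    from min[OF this] x show "r x = m x" by (metis ext_def)
  qed
qed

text \<open>
  Starting Zorn's lemma from the minorant \<open>lower N a\<close> instead of \<open>N\<close> forces the minimal functional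
  to attain the value \<open>N a\<close> at \<open>a\<close>.
\<close>

lemma Hahn_Banach_real:
  assumes N: "sublinear N" and a: "a \<in> carrier X"
  obtains u where "\<And>x y. \<lbrakk>x \<in> carrier X; y \<in> carrier X\<rbrakk> \<Longrightarrow> u (x \<oplus> y) = u x + u y"
    "\<And>t x. x \<in> carrier X \<Longrightarrow> u (of_real t \<odot>\<^bsub>X\<^esub> x) = t * u x"
    "\<And>x. x \<in> carrier X \<Longrightarrow> u x \<le> N x" "u a = N a"
proof -
  obtain u where u: "sublinear u" and u_le: "\<And>x. x \<in> carrier X \<Longrightarrow> u x \<le> lower N a x"
    and min: "\<And>r x. \<lbrakk>sublinear r; \<And>y. y \<in> carrier X \<Longrightarrow> r y \<le> u y; x \<in> carrier X\<rbrakk> \<Longrightarrow> r x = u x"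
    using minimal_sublinear[OF sublinear_lower[OF N a]] by blast
  have minus: "u (\<ominus> x) = - u x" if x: "x \<in> carrier X" for x
  proof (rule antisym)
    have "lower u x (\<ominus> x) = u (\<ominus> x)"
      using x u by (intro min sublinear_lower lower_le) auto
    with lower_minus[OF u x] show "u (\<ominus> x) \<le> - u x" by simp
  qed (rule sublinear_minus[OF u x])
  have le: "u x \<le> N x" if "x \<in> carrier X" for x
    using u_le[OF that] lower_le[OF N a that] by simp
  show thesis
  proof
    show "u (x \<oplus> y) = u x + u y" if "x \<in> carrier X" "y \<in> carrier X" for x y
      using sublinear_add[OF u that] sublinear_add[OF u, of "\<ominus> x" "\<ominus> y"] that minus[of "x \<oplus> y"]
      by (simp add: minus M.minus_add)
    show "u (of_real t \<odot>\<^bsub>X\<^esub> x) = t * u x" if x: "x \<in> carrier X" for t x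
    proof -
      consider "t = 0" | "0 < t" | "0 < - t" by linarith
      then show ?thesis
      proof cases
        case 3
        have "of_real t \<odot>\<^bsub>X\<^esub> x = \<ominus> (of_real (- t) \<odot>\<^bsub>X\<^esub> x)"
          using K_minus_one[of "of_real (- t) \<odot>\<^bsub>X\<^esub> x"] real_smult_assoc[OF x, of "-1" "-t"] x
          by (simp add: K_smult(1) del: of_real_minus) simp
        then show ?thesis
          using sublinear_smult[OF u 3 x] minus[of "of_real (- t) \<odot>\<^bsub>X\<^esub> x"] x
          by (simp add: K_smult(1) del: of_real_minus)
      qed (use x u sublinear_smult[of u t x] in \<open>auto simp: K_smult sublinear_zero\<close>)
    qed
    show "u x \<le> N x" if "x \<in> carrier X" for x by (rule le[OF that])
    show "u a = N a"
      using u_le[of "\<ominus> a"] lower_minus[OF N a] minus[OF a] le[OF a] a by simp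
  qed
qed

text \<open>
  In the complex case the real-linear functional \<open>u\<close> is the real part of \<open>\<phi> x = u x - i u (i x)\<close>.
  The bound on the modulus comes from rotating \<open>x\<close> so that \<open>\<phi> x\<close> becomes nonnegative; the value at
  \<open>a\<close> is then real, because its real part already exhausts the bound.
\<close>

theorem Hahn_Banach:
  assumes add: "\<And>x y. \<lbrakk>x \<in> carrier X; y \<in> carrier X\<rbrakk> \<Longrightarrow> N (x \<oplus> y) \<le> N x + N y"
    and smult: "\<And>c x. \<lbrakk>c \<in> K; x \<in> carrier X\<rbrakk> \<Longrightarrow> N (c \<odot>\<^bsub>X\<^esub> x) = norm c * N x"
    and a: "a \<in> carrier X"
  obtains \<phi> where "linear_map K X (scalar_field K) \<phi>"
    "\<And>x. x \<in> carrier X \<Longrightarrow> norm (\<phi> x) \<le> N x" "\<phi> a = of_real (N a)"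
proof -
  have "sublinear N" using add smult by (simp add: sublinear_def)
  then obtain u where u_add: "\<And>x y. \<lbrakk>x \<in> carrier X; y \<in> carrier X\<rbrakk> \<Longrightarrow> u (x \<oplus> y) = u x + u y"
    and u_smult: "\<And>t x. x \<in> carrier X \<Longrightarrow> u (of_real t \<odot>\<^bsub>X\<^esub> x) = t * u x"
    and u_le: "\<And>x. x \<in> carrier X \<Longrightarrow> u x \<le> N x" and u_a: "u a = N a"
    using Hahn_Banach_real[OF _ a] by metis
  show thesis
  proof (cases "K = UNIV")
    case False
    with K_cases have K: "K = \<real>" by blast
    show thesis
    proof
      show "linear_map K X (scalar_field K) (\<lambda>x. complex_of_real (u x))"
        using u_smult by (auto simp: linear_map_def scalar_field_def u_add K elim!: Reals_cases)
      show "norm (complex_of_real (u x)) \<le> N x" if "x \<in> carrier X" for x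
        using u_le[OF that] u_le[of "of_real (-1) \<odot>\<^bsub>X\<^esub> x"] u_smult[OF that, of "-1"]
          smult[of "-1", OF _ that] that K_smult(1)[OF that, of "-1"] by simp
    qed (simp add: u_a)
  next
    case True
    note K = True
    define \<phi> where "\<phi> x = Complex (u x) (- u (\<i> \<odot>\<^bsub>X\<^esub> x))" for x
    have lin: "linear_map K X (scalar_field K) \<phi>"
      unfolding linear_map_def
    proof (intro conjI ballI)
      show "\<phi> (x \<oplus> y) = \<phi> x \<oplus>\<^bsub>scalar_field K\<^esub> \<phi> y" if "x \<in> carrier X" "y \<in> carrier X" for x y
        using that by (simp add: \<phi>_def scalar_field_def K_smult_add K_smult(1) K u_add complex_eq_iff)
      fix c x assume x: "x \<in> carrier X"
      have ix: "\<i> \<odot>\<^bsub>X\<^esub> x \<in> carrier X" using x K by (simp add: K_smult)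
      have c: "of_real s \<odot>\<^bsub>X\<^esub> x \<oplus> of_real t \<odot>\<^bsub>X\<^esub> (\<i> \<odot>\<^bsub>X\<^esub> x) = d \<odot>\<^bsub>X\<^esub> x"
        if "d = Complex s t" for s t d
        using K_smult(2)[OF x, of "of_real s" "of_real t * \<i>"] K_smult(3)[OF x, of "of_real t" \<i>] that K
        by (simp add: Complex_eq mult.commute)
      have "u (c \<odot>\<^bsub>X\<^esub> x) = Re c * u x + Im c * u (\<i> \<odot>\<^bsub>X\<^esub> x)"
        using c[of c "Re c" "Im c"] u_add[of "of_real (Re c) \<odot>\<^bsub>X\<^esub> x" "of_real (Im c) \<odot>\<^bsub>X\<^esub> (\<i> \<odot>\<^bsub>X\<^esub> x)"] x ix
        by (simp add: K_smult(1) u_smult)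
      moreover have "u (\<i> \<odot>\<^bsub>X\<^esub> (c \<odot>\<^bsub>X\<^esub> x)) = - Im c * u x + Re c * u (\<i> \<odot>\<^bsub>X\<^esub> x)"
        using c[of "\<i> * c" "- Im c" "Re c"] K_smult(3)[OF x, of \<i> c] K x ix
          u_add[of "of_real (- Im c) \<odot>\<^bsub>X\<^esub> x" "of_real (Re c) \<odot>\<^bsub>X\<^esub> (\<i> \<odot>\<^bsub>X\<^esub> x)"]
        by (simp add: K_smult(1) u_smult complex_eq_iff del: of_real_minus)
      ultimately show "\<phi> (c \<odot>\<^bsub>X\<^esub> x) = c \<odot>\<^bsub>scalar_field K\<^esub> \<phi> x"
        by (simp add: \<phi>_def scalar_field_def complex_eq_iff)
    qed (simp add: scalar_field_def K)
    have bound: "norm (\<phi> x) \<le> N x" if x: "x \<in> carrier X" for x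
    proof (cases "\<phi> x = 0")
      case True
      then have "u x = 0" by (simp add: \<phi>_def complex_eq_iff)
      with u_le[OF x] True show ?thesis by simp
    next
      case False
      define c where "c = cnj (\<phi> x) / of_real (norm (\<phi> x))"
      have c1: "norm c = 1" using False by (simp add: c_def norm_divide)
      have "c * \<phi> x = of_real (norm (\<phi> x))"
        using False by (simp add: c_def complex_norm_square[symmetric] mult.commute power2_eq_square)
      then have "\<phi> (c \<odot>\<^bsub>X\<^esub> x) = of_real (norm (\<phi> x))"
        using lin x K by (simp add: linear_map_def scalar_field_def)
      then have "norm (\<phi> x) = u (c \<odot>\<^bsub>X\<^esub> x)" by (simp add: \<phi>_def complex_eq_iff)
      also have "\<dots> \<le> N x"
        using u_le[of "c \<odot>\<^bsub>X\<^esub> x"] smult[of c x] x K c1 by (simp add: K_smult(1))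
      finally show ?thesis .
    qed
    have "\<phi> a = of_real (N a)"
    proof -
      have "Re (\<phi> a) = N a" by (simp add: \<phi>_def u_a)
      moreover from bound[OF a] have "(Re (\<phi> a))\<^sup>2 + (Im (\<phi> a))\<^sup>2 \<le> (N a)\<^sup>2"
        using power_mono[of "norm (\<phi> a)" "N a" 2] by (simp add: cmod_power2)
      ultimately show ?thesis by (simp add: complex_eq_iff)
    qed
    with lin bound show thesis by (rule that)
  qed
qed

end

section \<open>The inequalities of Hoelder and Minkowski for finite sums\<close>

text \<open>
  The closing step of every duality argument below: a sum \<open>Z\<close> of \<open>p\<close>-th powers is estimated by its
  own power \<open>1 / q\<close>, which is then divided out.
\<close>

lemma dual_exponent_bound:
  fixes p q :: real
  assumes "1 < p" "1 / p + 1 / q = 1" and "0 \<le> Z" "0 \<le> M" and le: "Z \<le> M * Z powr (1 / q)"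
  shows "Z powr (1 / p) \<le> M"
proof (cases "Z = 0")
  case False
  with \<open>0 \<le> Z\<close> have "0 < Z" by simp
  moreover have "1 / p = 1 - 1 / q" using assms by simp
  ultimately show ?thesis
    using le by (simp add: powr_diff divide_le_eq)
qed (use assms in simp)

definition lnorm :: "real \<Rightarrow> 'i set \<Rightarrow> ('i \<Rightarrow> real) \<Rightarrow> real" where
  "lnorm p J a = (\<Sum>i\<in>J. a i powr p) powr (1 / p)"

lemma lnorm_nonneg: "0 \<le> lnorm p J a"
  by (simp add: lnorm_def)

lemma lnorm_powr: "p \<noteq> 0 \<Longrightarrow> lnorm p J a powr p = (\<Sum>i\<in>J. a i powr p)"
  by (simp add: lnorm_def powr_powr sum_nonneg)

lemma lnorm_mono:
  "\<lbrakk>0 < p; finite J; \<And>i. i \<in> J \<Longrightarrow> 0 \<le> a i \<and> a i \<le> b i\<rbrakk> \<Longrightarrow> lnorm p J a \<le> lnorm p J b"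
  unfolding lnorm_def by (intro powr_mono2 sum_mono sum_nonneg) auto

lemma Hoelder_sum:
  fixes p q :: real
  assumes "1 < p" "1 < q" and pq: "1 / p + 1 / q = 1" and "finite J"
    and a: "\<And>i. i \<in> J \<Longrightarrow> 0 \<le> a i" and b: "\<And>i. i \<in> J \<Longrightarrow> 0 \<le> b i"
  shows "(\<Sum>i\<in>J. a i * b i) \<le> lnorm p J a * lnorm q J b"
proof (cases "lnorm p J a = 0 \<or> lnorm q J b = 0")
  case True
  then have "(\<forall>i\<in>J. a i = 0) \<or> (\<forall>i\<in>J. b i = 0)"
    using \<open>finite J\<close> by (simp add: lnorm_def sum_nonneg_eq_0_iff)
  then have "(\<Sum>i\<in>J. a i * b i) = 0" by (auto intro!: sum.neutral)
  then show ?thesis by (simp add: lnorm_nonneg)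
next
  case False
  define S T where "S = lnorm p J a" and "T = lnorm q J b"
  have pos: "0 < S" "0 < T"
    using False lnorm_nonneg[of p J a] lnorm_nonneg[of q J b] by (auto simp: S_def T_def)
  have "(\<Sum>i\<in>J. a i * b i) / (S * T) = (\<Sum>i\<in>J. (a i / S) * (b i / T))"
    by (simp add: sum_divide_distrib)
  also have "\<dots> \<le> (\<Sum>i\<in>J. (a i / S) powr p / p + (b i / T) powr q / q)"
    using assms pos by (intro sum_mono Youngs_inequality) auto
  also have "\<dots> = (\<Sum>i\<in>J. a i powr p) / S powr p / p + (\<Sum>i\<in>J. b i powr q) / T powr q / q"
    using pos a b by (simp add: powr_divide sum.distrib sum_divide_distrib)
  also have "\<dots> = 1"
    using pos pq \<open>1 < p\<close> \<open>1 < q\<close> by (simp add: S_def T_def flip: lnorm_powr)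
  finally show ?thesis
    using pos by (simp add: divide_le_eq S_def T_def)
qed

lemma Minkowski_sum:
  fixes p :: real
  assumes p: "1 < p" and J: "finite J"
    and a: "\<And>i. i \<in> J \<Longrightarrow> 0 \<le> a i" and b: "\<And>i. i \<in> J \<Longrightarrow> 0 \<le> b i"
  shows "lnorm p J (\<lambda>i. a i + b i) \<le> lnorm p J a + lnorm p J b"
proof -
  define q where "q = p / (p - 1)"
  have q: "1 < q" "1 / p + 1 / q = 1" "(p - 1) * q = p"
    using p by (auto simp: q_def field_simps)
  define Z where "Z = (\<Sum>i\<in>J. (a i + b i) powr p)"
  define w where "w i = (a i + b i) powr (p - 1)" for i
  have w: "lnorm q J w = Z powr (1 / q)"
    using q by (simp add: lnorm_def w_def powr_powr Z_def)
  have "(a i + b i) powr p = (a i + b i) * w i" if "i \<in> J" for i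
    using powr_mult_base[of "a i + b i" "p - 1"] a[OF that] b[OF that] by (simp add: w_def)
  then have "Z = (\<Sum>i\<in>J. a i * w i) + (\<Sum>i\<in>J. b i * w i)"
    by (simp add: Z_def sum.distrib distrib_right)
  also have "\<dots> \<le> lnorm p J a * lnorm q J w + lnorm p J b * lnorm q J w"
    using assms q by (intro add_mono Hoelder_sum) (auto simp: w_def)
  finally have "Z \<le> (lnorm p J a + lnorm p J b) * Z powr (1 / q)"
    by (simp add: w distrib_right)
  then have "Z powr (1 / p) \<le> lnorm p J a + lnorm p J b"
    by (intro dual_exponent_bound[OF p q(2)]) (auto simp: Z_def sum_nonneg lnorm_nonneg)
  then show ?thesis by (simp add: lnorm_def Z_def)
qed

section \<open>Dual norms and norming functionals\<close>

locale normed_vector_space = normed_space K X for K and X :: "(complex, 'a) normed_module" (structure) +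
  assumes scalars: "K = \<real> \<or> K = UNIV"

sublocale normed_vector_space \<subseteq> scalar_module K X
  by (intro scalar_module.intro scalar_module_axioms.intro vector_space scalars)

context normed_vector_space
begin

lemma nrm_zero [simp]: "nrm X \<zero> = 0"
  by (simp add: nrm_eq_zero)

lemma dual_D:
  assumes "g \<in> dual K X"
  shows "\<lbrakk>x \<in> carrier X; y \<in> carrier X\<rbrakk> \<Longrightarrow> g (x \<oplus> y) = g x + g y"
    and "\<lbrakk>c \<in> K; x \<in> carrier X\<rbrakk> \<Longrightarrow> g (c \<odot>\<^bsub>X\<^esub> x) = c * g x"
  using assms by (auto simp: dual_def bounded_operators_def linear_map_def scalar_field_def)

lemma dualI:
  assumes "linear_map K X (scalar_field K) g" "\<And>x. x \<in> carrier X \<Longrightarrow> norm (g x) \<le> C * nrm X x"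
  shows "g \<in> dual K X"
  using assms by (auto simp: dual_def bounded_operators_def scalar_field_def)

lemma dual_bdd_above:
  assumes g: "g \<in> dual K X"
  shows "bdd_above ((\<lambda>x. norm (g x)) ` {x \<in> carrier X. nrm X x \<le> 1})"
proof -
  obtain C where C: "\<And>x. x \<in> carrier X \<Longrightarrow> norm (g x) \<le> C * nrm X x"
    using g by (auto simp: dual_def bounded_operators_def scalar_field_def)
  have "norm (g y) \<le> \<bar>C\<bar>" if "y \<in> carrier X" "nrm X y \<le> 1" for y
  proof -
    have "C * nrm X y \<le> \<bar>C\<bar> * 1"
      using that nrm_nonneg[of y] by (intro mult_mono) auto
    with C[OF that(1)] show ?thesis by simp
  qed
  then show ?thesis
    by (intro bdd_aboveI2) auto
qed

lemma norm_le_dual_norm: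
  assumes g: "g \<in> dual K X" and x: "x \<in> carrier X"
  shows "norm (g x) \<le> dual_norm X g * nrm X x"
proof (cases "x = \<zero>")
  case True
  then show ?thesis
    using dual_D(2)[OF g, of 0 \<zero>] of_real_K[of 0] K_smult_zero[of 0] by simp
next
  case False
  let ?r = "1 / nrm X x"
  have pos: "0 < nrm X x"
    using False x nrm_nonneg[of x] nrm_eq_zero[of x] by linarith
  have "norm (g (of_real ?r \<odot>\<^bsub>X\<^esub> x)) \<le> dual_norm X g"
    unfolding dual_norm_def using x pos K_smult(1)[OF x of_real_K, of ?r] nrm_smult[OF of_real_K x, of ?r]
    by (intro cSUP_upper[OF _ dual_bdd_above[OF g]]) (auto simp: norm_divide)
  then have "norm (of_real ?r * g x) \<le> dual_norm X g"
    by (simp only: dual_D(2)[OF g of_real_K x])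
  then show ?thesis
    using pos by (simp add: norm_mult norm_divide field_simps)
qed

lemma dual_norm_le:
  assumes "\<And>x. \<lbrakk>x \<in> carrier X; nrm X x \<le> 1\<rbrakk> \<Longrightarrow> norm (g x) \<le> C"
  shows "dual_norm X g \<le> C"
  unfolding dual_norm_def
proof (rule cSUP_least)
  have "\<zero> \<in> {x \<in> carrier X. nrm X x \<le> 1}" by simp
  then show "{x \<in> carrier X. nrm X x \<le> 1} \<noteq> {}" by blast
qed (use assms in auto)

lemma dual_norm_nonneg:
  assumes "g \<in> dual K X" shows "0 \<le> dual_norm X g"
proof -
  have "norm (g \<zero>) \<le> dual_norm X g"
    unfolding dual_norm_def by (intro cSUP_upper[OF _ dual_bdd_above[OF assms]]) simp
  then show ?thesis
    using norm_ge_zero order_trans by blast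
qed

lemma norming_functional:
  assumes a: "a \<in> carrier X" and s: "0 \<le> s"
  obtains g where "g \<in> dual K X" "dual_norm X g \<le> s" "g a = of_real (s * nrm X a)"
proof -
  obtain g where g: "linear_map K X (scalar_field K) g"
    "\<And>x. x \<in> carrier X \<Longrightarrow> norm (g x) \<le> s * nrm X x" "g a = of_real (s * nrm X a)"
  proof (rule Hahn_Banach[of "\<lambda>x. s * nrm X x" a])
    show "s * nrm X (x \<oplus> y) \<le> s * nrm X x + s * nrm X y"
      if "x \<in> carrier X" "y \<in> carrier X" for x y
      using mult_left_mono[OF nrm_triangle[OF that] s] by (simp add: distrib_left)
  qed (use a nrm_smult in auto)
  show thesis
  proof
    show "dual_norm X g \<le> s"
    proof (rule dual_norm_le)
      fix x assume "x \<in> carrier X" "nrm X x \<le> 1"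
      with g(2)[of x] mult_left_mono[of "nrm X x" 1 s] s show "norm (g x) \<le> s" by simp
    qed
  qed (use g dualI in auto)
qed

end

section \<open>Bounds from below through approximate preimages\<close>

lemma linear_map_minus:
  assumes "normed_vector_space K X" "normed_vector_space K W" and T: "linear_map K X W T"
    and x: "x \<in> carrier X" and y: "y \<in> carrier X"
  shows "T (x \<ominus>\<^bsub>X\<^esub> y) = T x \<ominus>\<^bsub>W\<^esub> T y"
proof -
  interpret X: normed_vector_space K X by fact
  interpret W: normed_vector_space K W by fact
  have "T (\<ominus>\<^bsub>X\<^esub> y) = (- 1) \<odot>\<^bsub>W\<^esub> T y"
    using T y X.minus_one_K by (simp add: linear_map_def X.K_minus_one[symmetric])
  also have "\<dots> = \<ominus>\<^bsub>W\<^esub> T y"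
    using T y by (intro W.K_minus_one) (auto simp: linear_map_def)
  finally show ?thesis
    using T x y by (simp add: linear_map_def a_minus_def)
qed

text \<open>
  This is the successive approximation of the open mapping theorem, keeping track of the constant.
  With \<open>c\<close> large, the approximation property yields \<open>f\<close> of norm about \<open>\<parallel>U x\<parallel> / A\<close> such that
  \<open>U (x - f)\<close> is a small fraction of \<open>U x\<close>. Repeating this for \<open>x - f\<close> produces a Cauchy sequence of
  remainders, whose limit lies in the kernel of \<open>U\<close> and thus is \<open>0\<close>. Hence \<open>x\<close> is the sum of the
  pieces \<open>f\<close>, whose norms are dominated by a geometric series with sum close to \<open>\<parallel>U x\<parallel> / A\<close>.
\<close>

lemma bounded_below_if_approx:
  assumes "banach_space K X" and scal: "K = \<real> \<or> K = UNIV" and W: "normed_vector_space K W"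
    and U: "linear_map K X W U" and A: "0 < A"
    and bound: "\<And>x. x \<in> carrier X \<Longrightarrow> nrm W (U x) \<le> B * nrm X x"
    and inj: "\<And>x. \<lbrakk>x \<in> carrier X; U x = \<zero>\<^bsub>W\<^esub>\<rbrakk> \<Longrightarrow> x = \<zero>\<^bsub>X\<^esub>"
    and approx: "\<And>x c \<epsilon>. \<lbrakk>x \<in> carrier X; 0 < c; 0 < \<epsilon>\<rbrakk> \<Longrightarrow>
      \<exists>f\<in>carrier X. nrm X f + c * nrm W (U x \<ominus>\<^bsub>W\<^esub> U f) \<le> nrm W (U x) / A + \<epsilon>"
    and x: "x \<in> carrier X"
  shows "A * nrm X x \<le> nrm W (U x)"
proof -
  interpret banach_space K X by fact
  interpret X: normed_vector_space K X
    by unfold_locales (rule scal)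
  interpret W: normed_vector_space K W by (rule W)
  interpret M: Metric_space "carrier X" "nrm_dist X" by (rule Metric_space_nrm_dist)
  note U_minus = linear_map_minus[OF X.normed_vector_space_axioms W U]
  have U_closed: "z \<in> carrier X \<Longrightarrow> U z \<in> carrier W" for z
    using U by (auto simp: linear_map_def)
  have dist: "nrm_dist X y z = nrm X (y \<ominus>\<^bsub>X\<^esub> z)" if "y \<in> carrier X" "z \<in> carrier X" for y z
    using that by (simp add: nrm_dist_def)
  have main: "nrm X x \<le> (1 + \<eta>) * (nrm W (U x) + \<eta>) / (A * (1 - \<eta>))" if \<eta>: "0 < \<eta>" "\<eta> < 1" for \<eta>
  proof -
    \<comment> \<open>The summand \<open>\<eta>\<close> keeps \<open>t\<close> positive, so that the approximation errors below are positive.\<close>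
    define t where "t = nrm W (U x) + \<eta>"
    define C where "C = (1 + \<eta>) * t / A"
    have t: "0 < t" using W.nrm_nonneg[OF U_closed[OF x]] \<eta> by (simp add: t_def)
    have C: "0 \<le> C" using t \<eta> A by (simp add: C_def)
    have step: "\<exists>z'. (z' \<in> carrier X \<and> nrm W (U z') \<le> \<eta> ^ Suc k * t) \<and> nrm_dist X z z' \<le> C * \<eta> ^ k"
      if z: "z \<in> carrier X \<and> nrm W (U z) \<le> \<eta> ^ k * t" for z k
    proof -
      \<comment> \<open>\<open>c\<close> is chosen such that the bound \<open>C * \<eta> ^ k\<close> on the sum turns into \<open>\<eta> ^ Suc k * t\<close>
        after division by \<open>c\<close>.\<close>
      define c \<epsilon> where "c = (1 + \<eta>) / (A * \<eta>)" and "\<epsilon> = \<eta> * (\<eta> ^ k * t) / A"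
      have "0 < c" "0 < \<epsilon>" using \<eta> A t by (auto simp: c_def \<epsilon>_def)
      from approx[OF conjunct1[OF z] this] obtain f where f: "f \<in> carrier X"
        and "nrm X f + c * nrm W (U z \<ominus>\<^bsub>W\<^esub> U f) \<le> nrm W (U z) / A + \<epsilon>" by blast
      moreover have "nrm W (U z) / A + \<epsilon> \<le> C * \<eta> ^ k"
      proof -
        have "nrm W (U z) / A \<le> (\<eta> ^ k * t) / A"
          using z A by (intro divide_right_mono) auto
        then show ?thesis by (simp add: C_def \<epsilon>_def algebra_simps add_divide_distrib)
      qed
      ultimately have le: "nrm X f + c * nrm W (U z \<ominus>\<^bsub>W\<^esub> U f) \<le> C * \<eta> ^ k" by simp
      have nn: "0 \<le> nrm X f" "0 \<le> nrm W (U z \<ominus>\<^bsub>W\<^esub> U f)"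
        using f z U_closed nrm_nonneg W.nrm_nonneg by auto
      have "c * nrm W (U z \<ominus>\<^bsub>W\<^esub> U f) \<le> C * \<eta> ^ k" using le nn by simp
      also have "\<dots> = c * (\<eta> ^ Suc k * t)" using \<eta> A by (simp add: C_def c_def)
      finally have 1: "nrm W (U z \<ominus>\<^bsub>W\<^esub> U f) \<le> \<eta> ^ Suc k * t" using \<open>0 < c\<close> by simp
      have "z \<ominus>\<^bsub>X\<^esub> (z \<ominus>\<^bsub>X\<^esub> f) = f"
        using f z by (simp add: X.M.minus_eq X.M.minus_add X.M.a_assoc[symmetric] X.M.r_neg)
      then have "nrm_dist X z (z \<ominus>\<^bsub>X\<^esub> f) \<le> C * \<eta> ^ k"
        using f z le nn \<open>0 < c\<close> by (simp add: dist) (smt (verit) mult_nonneg_nonneg)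
      with 1 f z show ?thesis
        by (intro exI[of _ "z \<ominus>\<^bsub>X\<^esub> f"]) (simp add: U_minus)
    qed
    have start: "x \<in> carrier X \<and> nrm W (U x) \<le> \<eta> ^ 0 * t" using x \<eta> by (simp add: t_def)
    define Q where "Q k z \<longleftrightarrow> z \<in> carrier X \<and> nrm W (U z) \<le> \<eta> ^ k * t \<and> (k = 0 \<longrightarrow> z = x)" for k z
    obtain z where z: "\<And>k. Q k (z k)" and dz: "\<And>k. nrm_dist X (z k) (z (Suc k)) \<le> C * \<eta> ^ k"
    proof (rule exE[OF dependent_nat_choice[of Q "\<lambda>k y y'. nrm_dist X y y' \<le> C * \<eta> ^ k"]])
      show "\<exists>y. Q 0 y" using start by (auto simp: Q_def)
      show "\<exists>y'. Q (Suc k) y' \<and> nrm_dist X y y' \<le> C * \<eta> ^ k" if "Q k y" for y k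
        using step[of y k] that by (auto simp: Q_def)
    qed auto
    have zc [simp]: "z k \<in> carrier X" and Uz: "nrm W (U (z k)) \<le> \<eta> ^ k * t" for k
      using z by (auto simp: Q_def)
    have z0: "z 0 = x" using z[of 0] by (simp add: Q_def)
    have geo: "nrm_dist X (z m) (z (m + d)) \<le> C * (\<eta> ^ m - \<eta> ^ (m + d)) / (1 - \<eta>)" for m d
    proof (induction d)
      case 0
      then show ?case using M.mdist_zero[of "z m"] by simp
    next
      case (Suc d)
      have "nrm_dist X (z m) (z (m + Suc d)) \<le> C * (\<eta> ^ m - \<eta> ^ (m + d)) / (1 - \<eta>) + C * \<eta> ^ (m + d)"
        using M.triangle[OF zc[of m] zc[of "m + d"] zc[of "m + Suc d"]] Suc dz[of "m + d"] by simp
      also have "\<dots> = C * (\<eta> ^ m - \<eta> ^ (m + Suc d)) / (1 - \<eta>)"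
        using \<eta> by (simp add: field_simps)
      finally show ?case .
    qed
    have tail: "nrm_dist X (z m) (z n) \<le> C / (1 - \<eta>) * \<eta> ^ m" if "m \<le> n" for m n
    proof -
      have "C * (\<eta> ^ m - \<eta> ^ n) / (1 - \<eta>) \<le> C * \<eta> ^ m / (1 - \<eta>)"
        using \<eta> C by (intro divide_right_mono mult_left_mono) auto
      with geo[of m "n - m"] that show ?thesis by simp
    qed
    have "(\<lambda>k. C / (1 - \<eta>) * \<eta> ^ k) \<longlonglongrightarrow> C / (1 - \<eta>) * 0"
      using \<eta> by (intro tendsto_intros LIMSEQ_power_zero) simp
    then have lim0: "(\<lambda>k. C / (1 - \<eta>) * \<eta> ^ k) \<longlonglongrightarrow> 0" by simp
    have "M.MCauchy z"
      unfolding M.MCauchy_def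
    proof (intro conjI allI impI)
      show "range z \<subseteq> carrier X" by auto
      fix \<epsilon> :: real assume "0 < \<epsilon>"
      with lim0 have "\<forall>\<^sub>F k in sequentially. C / (1 - \<eta>) * \<eta> ^ k < \<epsilon>"
        by (rule order_tendstoD(2))
      then obtain N where N: "\<And>k. N \<le> k \<Longrightarrow> C / (1 - \<eta>) * \<eta> ^ k < \<epsilon>"
        by (auto simp: eventually_sequentially)
      have "nrm_dist X (z n) (z n') < \<epsilon>" if "N \<le> n" "N \<le> n'" for n n'
        using tail[of n n'] tail[of n' n] N[OF that(1)] N[OF that(2)] M.commute[of "z n" "z n'"]
        by (cases "n \<le> n'") auto
      then show "\<exists>N. \<forall>n n'. N \<le> n \<longrightarrow> N \<le> n' \<longrightarrow> nrm_dist X (z n) (z n') < \<epsilon>" by blast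
    qed
    then obtain y where "limitin M.mtopology z y sequentially"
      using complete by (auto simp: M.mcomplete_def)
    then have y: "y \<in> carrier X" and lim: "(\<lambda>k. nrm_dist X (z k) y) \<longlonglongrightarrow> 0"
      by (auto simp: M.limitin_metric_dist_null)
    have "nrm W (U y) \<le> B * nrm_dist X (z k) y + \<eta> ^ k * t" for k
    proof -
      have "U (y \<ominus>\<^bsub>X\<^esub> z k) = U y \<ominus>\<^bsub>W\<^esub> U (z k)" using U_minus[OF y zc] .
      then have "U y = U (y \<ominus>\<^bsub>X\<^esub> z k) \<oplus>\<^bsub>W\<^esub> U (z k)"
        using y U_closed by (simp add: W.M.minus_eq W.M.a_assoc W.M.l_neg)
      then have "nrm W (U y) \<le> nrm W (U (y \<ominus>\<^bsub>X\<^esub> z k)) + nrm W (U (z k))"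
        using W.nrm_triangle[of "U (y \<ominus>\<^bsub>X\<^esub> z k)" "U (z k)"] U_closed y by simp
      also have "\<dots> \<le> B * nrm X (y \<ominus>\<^bsub>X\<^esub> z k) + \<eta> ^ k * t"
        using bound[of "y \<ominus>\<^bsub>X\<^esub> z k"] y Uz[of k] by simp
      finally show ?thesis using y M.commute[of y "z k"] by (simp add: dist)
    qed
    moreover have "(\<lambda>k. B * nrm_dist X (z k) y + \<eta> ^ k * t) \<longlonglongrightarrow> B * 0 + 0 * t"
      using \<eta> by (intro tendsto_intros lim LIMSEQ_power_zero) simp
    ultimately have "nrm W (U y) \<le> 0"
      by (intro LIMSEQ_le_const[where X="\<lambda>k. B * nrm_dist X (z k) y + \<eta> ^ k * t"]) auto
    then have "nrm W (U y) = 0"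
      using W.nrm_nonneg[OF U_closed[OF y]] by simp
    then have "U y = \<zero>\<^bsub>W\<^esub>"
      using W.nrm_eq_zero[OF U_closed[OF y]] by simp
    then have y0: "y = \<zero>\<^bsub>X\<^esub>" using inj y by blast
    have "\<ominus>\<^bsub>X\<^esub> \<zero>\<^bsub>X\<^esub> = \<zero>\<^bsub>X\<^esub>"
      by (rule X.M.minus_equality) auto
    then have "x \<ominus>\<^bsub>X\<^esub> \<zero>\<^bsub>X\<^esub> = x" using x by (simp only: X.M.minus_eq X.M.r_zero)
    then have "nrm_dist X x y = nrm X x" using x y y0 by (simp add: dist)
    then have "nrm X x \<le> C / (1 - \<eta>) + nrm_dist X (z k) y" for k
      using M.triangle[of x "z k" y] tail[of 0 k] x y z0 by simp
    then have "nrm X x \<le> C / (1 - \<eta>) + 0"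
      by (intro LIMSEQ_le_const[where X="\<lambda>k. C / (1 - \<eta>) + nrm_dist X (z k) y"] tendsto_intros lim) auto
    then show ?thesis by (simp add: C_def t_def)
  qed
  have "((\<lambda>\<eta>. (1 + \<eta>) * (nrm W (U x) + \<eta>) / (A * (1 - \<eta>))) \<longlongrightarrow>
      (1 + 0) * (nrm W (U x) + 0) / (A * (1 - 0))) (at_right 0)"
    using A by (intro tendsto_intros) auto
  moreover have "\<forall>\<^sub>F \<eta> in at_right 0. nrm X x \<le> (1 + \<eta>) * (nrm W (U x) + \<eta>) / (A * (1 - \<eta>))"
    by (rule eventually_mono[OF eventually_at_right_real[of 0 1]]) (auto intro: main)
  ultimately have "nrm X x \<le> nrm W (U x) / A"
    using tendsto_lowerbound[of _ _ "at_right (0::real)" "nrm X x"] by simp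
  then show ?thesis using A by (simp add: field_simps)
qed

section \<open>The direct sum of a family of normed spaces\<close>

text \<open>
  The \<open>\<ell>\<^sup>p\<close> direct sum of the spaces \<open>Y i\<close>. Its elements are extensional, as otherwise a vector would be
  represented by many functions and the norm would not separate points.
\<close>

definition lp_sum :: "real \<Rightarrow> 'i set \<Rightarrow> ('i \<Rightarrow> (complex, 'b) normed_module)
    \<Rightarrow> (complex, 'i \<Rightarrow> 'b) normed_module" where
  "lp_sum p I Y =
     \<lparr>carrier = {y \<in> \<Pi>\<^sub>E i\<in>I. carrier (Y i). (\<lambda>i. nrm (Y i) (y i) powr p) summable_on I},
      mult = undefined, one = undefined, zero = (\<lambda>i\<in>I. \<zero>\<^bsub>Y i\<^esub>),
      add = (\<lambda>y z. \<lambda>i\<in>I. y i \<oplus>\<^bsub>Y i\<^esub> z i), smult = (\<lambda>c y. \<lambda>i\<in>I. c \<odot>\<^bsub>Y i\<^esub> y i),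
      nrm = (\<lambda>y. (\<Sum>\<^sub>\<infinity>i\<in>I. nrm (Y i) (y i) powr p) powr (1 / p))\<rparr>"

lemma disjoint_sum_le_tail:
  fixes a :: "'i \<Rightarrow> real"
  assumes "a summable_on I" "\<And>i. i \<in> I \<Longrightarrow> 0 \<le> a i"
    and "finite J" "J \<subseteq> I" "finite J'" "J' \<subseteq> I" "J \<inter> J' = {}"
  shows "sum a J' \<le> infsum a I - sum a J"
proof -
  have "sum a (J \<union> J') \<le> infsum a I"
    using assms by (intro finite_sum_le_infsum) auto
  then show ?thesis using assms by (simp add: sum.union_disjoint)
qed

lemma tail_powr_tendsto_0:
  fixes a :: "'i \<Rightarrow> real"
  assumes "a summable_on I" "\<And>i. i \<in> I \<Longrightarrow> 0 \<le> a i" "0 < r"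
  shows "((\<lambda>J. (infsum a I - sum a J) powr r) \<longlongrightarrow> 0) (finite_subsets_at_top I)"
proof -
  have "((\<lambda>J. infsum a I - sum a J) \<longlongrightarrow> infsum a I - infsum a I) (finite_subsets_at_top I)"
    by (intro tendsto_intros infsum_tendsto assms)
  moreover have "\<forall>\<^sub>F J in finite_subsets_at_top I. 0 \<le> infsum a I - sum a J"
    using disjoint_sum_le_tail[OF assms(1,2), where J'="{}"]
    by (intro eventually_finite_subsets_at_top_weakI) auto
  ultimately have "((\<lambda>J. (infsum a I - sum a J) powr r) \<longlongrightarrow> 0 powr r) (finite_subsets_at_top I)"
    using assms(3) by (intro tendsto_powr') auto
  then show ?thesis by simp
qed

locale lp_family =
  fixes K :: "complex set" and p q :: real and I :: "'i set"
    and Y :: "'i \<Rightarrow> (complex, 'b) normed_module"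
  assumes scalars: "K = \<real> \<or> K = UNIV"
    and p: "1 < p" and q: "1 < q" and pq: "1 / p + 1 / q = 1"
    and Y: "\<And>i. i \<in> I \<Longrightarrow> normed_vector_space K (Y i)"
begin

abbreviation "W \<equiv> lp_sum p I Y"

lemma nrm_Y_nonneg: "\<lbrakk>i \<in> I; y \<in> carrier (Y i)\<rbrakk> \<Longrightarrow> 0 \<le> nrm (Y i) y"
  by (rule normed_space.nrm_nonneg[OF normed_vector_space.axioms(1)[OF Y]])

lemma W_simps:
  "y \<in> carrier W \<longleftrightarrow> y \<in> (\<Pi>\<^sub>E i\<in>I. carrier (Y i)) \<and> (\<lambda>i. nrm (Y i) (y i) powr p) summable_on I"
  "y \<oplus>\<^bsub>W\<^esub> z = (\<lambda>i\<in>I. y i \<oplus>\<^bsub>Y i\<^esub> z i)"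
  "c \<odot>\<^bsub>W\<^esub> y = (\<lambda>i\<in>I. c \<odot>\<^bsub>Y i\<^esub> y i)"
  "\<zero>\<^bsub>W\<^esub> = (\<lambda>i\<in>I. \<zero>\<^bsub>Y i\<^esub>)"
  "nrm W y = (\<Sum>\<^sub>\<infinity>i\<in>I. nrm (Y i) (y i) powr p) powr (1 / p)"
  by (simp_all add: lp_sum_def)

lemma W_component: "\<lbrakk>y \<in> carrier W; i \<in> I\<rbrakk> \<Longrightarrow> y i \<in> carrier (Y i)"
  by (auto simp: W_simps)

lemma lnorm_le_nrm:
  assumes "y \<in> carrier W" "finite J" "J \<subseteq> I"
  shows "lnorm p J (\<lambda>i. nrm (Y i) (y i)) \<le> nrm W y"
  unfolding lnorm_def W_simps(5)
  using assms p by (intro powr_mono2 finite_sum_le_infsum sum_nonneg) (auto simp: W_simps)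

text \<open>
  Membership and norm are controlled by the finite partial norms alone; this is how the finite
  inequalities of Minkowski and of a Riesz basis are transferred to the infinite sum.
\<close>

lemma
  assumes y: "y \<in> (\<Pi>\<^sub>E i\<in>I. carrier (Y i))"
    and M: "\<And>J. \<lbrakk>finite J; J \<subseteq> I\<rbrakk> \<Longrightarrow> lnorm p J (\<lambda>i. nrm (Y i) (y i)) \<le> M"
  shows W_memI: "y \<in> carrier W" and nrm_W_le: "nrm W y \<le> M"
proof -
  have M0: "0 \<le> M" using M[of "{}"] by (simp add: lnorm_def)
  have le: "(\<Sum>i\<in>J. nrm (Y i) (y i) powr p) \<le> M powr p" if "finite J" "J \<subseteq> I" for J
    using powr_mono2[OF _ lnorm_nonneg M[OF that], of p] p by (simp add: lnorm_powr)
  have sm: "(\<lambda>i. nrm (Y i) (y i) powr p) summable_on I"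
    using le by (intro nonneg_bdd_above_summable_on bdd_aboveI2[where M="M powr p"]) auto
  then show "y \<in> carrier W" using y by (simp add: W_simps)
  have "(\<Sum>\<^sub>\<infinity>i\<in>I. nrm (Y i) (y i) powr p) \<le> M powr p"
    by (rule infsum_le_finite_sums[OF sm le])
  then have "nrm W y \<le> (M powr p) powr (1 / p)"
    unfolding W_simps(5) using p by (intro powr_mono2 infsum_nonneg) auto
  then show "nrm W y \<le> M" using p M0 by (simp add: powr_powr)
qed

lemma W_add:
  assumes y: "y \<in> carrier W" and z: "z \<in> carrier W"
  shows "y \<oplus>\<^bsub>W\<^esub> z \<in> carrier W" and "nrm W (y \<oplus>\<^bsub>W\<^esub> z) \<le> nrm W y + nrm W z"
proof -
  have "(y \<oplus>\<^bsub>W\<^esub> z) i \<in> carrier (Y i)" if i: "i \<in> I" for i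
  proof -
    interpret Yi: normed_vector_space K "Y i" by (rule Y[OF i])
    show ?thesis using W_component[OF y i] W_component[OF z i] i by (simp add: W_simps(2))
  qed
  then have mem: "y \<oplus>\<^bsub>W\<^esub> z \<in> (\<Pi>\<^sub>E i\<in>I. carrier (Y i))"
    by (intro PiE_I) (simp_all add: W_simps(2))
  have le: "lnorm p J (\<lambda>i. nrm (Y i) ((y \<oplus>\<^bsub>W\<^esub> z) i)) \<le> nrm W y + nrm W z"
    if J: "finite J" "J \<subseteq> I" for J
  proof -
    have "lnorm p J (\<lambda>i. nrm (Y i) ((y \<oplus>\<^bsub>W\<^esub> z) i)) \<le> lnorm p J (\<lambda>i. nrm (Y i) (y i) + nrm (Y i) (z i))"
    proof (rule lnorm_mono)
      fix i assume "i \<in> J"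
      then have i: "i \<in> I" using J by auto
      interpret Yi: normed_vector_space K "Y i" by (rule Y[OF i])
      show "0 \<le> nrm (Y i) ((y \<oplus>\<^bsub>W\<^esub> z) i) \<and> nrm (Y i) ((y \<oplus>\<^bsub>W\<^esub> z) i) \<le> nrm (Y i) (y i) + nrm (Y i) (z i)"
        using W_component[OF y i] W_component[OF z i] i
        by (simp add: W_simps(2) Yi.nrm_nonneg Yi.nrm_triangle)
    qed (use p J in auto)
    also have "\<dots> \<le> lnorm p J (\<lambda>i. nrm (Y i) (y i)) + lnorm p J (\<lambda>i. nrm (Y i) (z i))"
      using J p W_component[OF y] W_component[OF z]
      by (intro Minkowski_sum) (auto intro!: nrm_Y_nonneg)
    also have "\<dots> \<le> nrm W y + nrm W z"
      using J by (intro add_mono lnorm_le_nrm y z)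
    finally show ?thesis .
  qed
  show "y \<oplus>\<^bsub>W\<^esub> z \<in> carrier W"
    by (rule W_memI[OF mem le])
  show "nrm W (y \<oplus>\<^bsub>W\<^esub> z) \<le> nrm W y + nrm W z"
    by (rule nrm_W_le[OF mem le])
qed

lemma W_smult:
  assumes y: "y \<in> carrier W" and c: "c \<in> K"
  shows "c \<odot>\<^bsub>W\<^esub> y \<in> carrier W" and "nrm W (c \<odot>\<^bsub>W\<^esub> y) = norm c * nrm W y"
proof -
  have comp: "(c \<odot>\<^bsub>W\<^esub> y) i \<in> carrier (Y i)" "nrm (Y i) ((c \<odot>\<^bsub>W\<^esub> y) i) = norm c * nrm (Y i) (y i)"
    if i: "i \<in> I" for i
  proof -
    interpret Yi: normed_vector_space K "Y i" by (rule Y[OF i])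
    show "(c \<odot>\<^bsub>W\<^esub> y) i \<in> carrier (Y i)" "nrm (Y i) ((c \<odot>\<^bsub>W\<^esub> y) i) = norm c * nrm (Y i) (y i)"
      using W_component[OF y i] i c by (simp_all add: W_simps(3) Yi.K_smult(1) Yi.nrm_smult)
  qed
  have eq: "nrm (Y i) ((c \<odot>\<^bsub>W\<^esub> y) i) powr p = norm c powr p * nrm (Y i) (y i) powr p" if "i \<in> I" for i
    using comp(2)[OF that] nrm_Y_nonneg[OF that W_component[OF y that]] by (simp add: powr_mult)
  have "(\<lambda>i. norm c powr p * nrm (Y i) (y i) powr p) summable_on I"
    using y by (intro summable_on_cmult_right) (simp add: W_simps(1))
  moreover have "(\<lambda>i. nrm (Y i) ((c \<odot>\<^bsub>W\<^esub> y) i) powr p) summable_on I \<longleftrightarrow>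
      (\<lambda>i. norm c powr p * nrm (Y i) (y i) powr p) summable_on I"
    by (rule summable_on_cong) (rule eq)
  ultimately have "(\<lambda>i. nrm (Y i) ((c \<odot>\<^bsub>W\<^esub> y) i) powr p) summable_on I" by blast
  moreover have "c \<odot>\<^bsub>W\<^esub> y \<in> (\<Pi>\<^sub>E i\<in>I. carrier (Y i))"
    by (intro PiE_I comp(1)) (simp_all add: W_simps(3))
  ultimately show "c \<odot>\<^bsub>W\<^esub> y \<in> carrier W" by (simp add: W_simps(1))
  have "(\<Sum>\<^sub>\<infinity>i\<in>I. nrm (Y i) ((c \<odot>\<^bsub>W\<^esub> y) i) powr p) = (\<Sum>\<^sub>\<infinity>i\<in>I. norm c powr p * nrm (Y i) (y i) powr p)"
    by (rule infsum_cong) (rule eq)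
  also have "\<dots> = norm c powr p * (\<Sum>\<^sub>\<infinity>i\<in>I. nrm (Y i) (y i) powr p)"
    by (rule infsum_cmult_right')
  finally have "nrm W (c \<odot>\<^bsub>W\<^esub> y) = (norm c powr p * (\<Sum>\<^sub>\<infinity>i\<in>I. nrm (Y i) (y i) powr p)) powr (1 / p)"
    by (simp only: W_simps(5))
  also have "\<dots> = (norm c powr p) powr (1 / p) * nrm W y"
    unfolding W_simps(5) by (intro powr_mult)
  also have "(norm c powr p) powr (1 / p) = norm c"
    using p by (simp add: powr_powr)
  finally show "nrm W (c \<odot>\<^bsub>W\<^esub> y) = norm c * nrm W y" .
qed

lemma W_zero: "\<zero>\<^bsub>W\<^esub> \<in> carrier W" "nrm W \<zero>\<^bsub>W\<^esub> = 0"
proof -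
  have z: "nrm (Y i) (\<zero>\<^bsub>W\<^esub> i) powr p = 0" "\<zero>\<^bsub>W\<^esub> i \<in> carrier (Y i)" if i: "i \<in> I" for i
  proof -
    interpret Yi: normed_vector_space K "Y i" by (rule Y[OF i])
    show "nrm (Y i) (\<zero>\<^bsub>W\<^esub> i) powr p = 0" "\<zero>\<^bsub>W\<^esub> i \<in> carrier (Y i)"
      using i by (simp_all add: W_simps(4))
  qed
  have "(\<lambda>i. nrm (Y i) (\<zero>\<^bsub>W\<^esub> i) powr p) summable_on I"
    by (subst summable_on_cong[of I _ "\<lambda>_. 0"]) (rule z(1), auto)
  moreover have "\<zero>\<^bsub>W\<^esub> \<in> (\<Pi>\<^sub>E i\<in>I. carrier (Y i))"
    by (intro PiE_I z(2)) (simp_all add: W_simps(4))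
  ultimately show "\<zero>\<^bsub>W\<^esub> \<in> carrier W" by (simp add: W_simps(1))
  have "(\<Sum>\<^sub>\<infinity>i\<in>I. nrm (Y i) (\<zero>\<^bsub>W\<^esub> i) powr p) = 0"
    by (rule infsum_0) (rule z(1))
  then show "nrm W \<zero>\<^bsub>W\<^esub> = 0" by (simp add: W_simps(5))
qed

lemma W_ext:
  assumes "y \<in> extensional I" "z \<in> extensional I" "\<And>i. i \<in> I \<Longrightarrow> y i = z i"
  shows "y = z"
  using assms by (rule extensionalityI)

lemma W_extensional: "y \<in> carrier W \<Longrightarrow> y \<in> extensional I"
  by (simp add: W_simps(1) PiE_def)

lemma normed_W: "normed_vector_space K W"
proof (intro normed_vector_space.intro normed_space.intro normed_vector_space_axioms.intro scalars)
  note comp = W_component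
  have ag: "abelian_group (Y i)" and ms: "Module.module (scalar_field K) (Y i)" if "i \<in> I" for i
    using Y[OF that] by (auto simp: normed_vector_space_def normed_space_def Module.module_def)
  have am: "abelian_monoid (Y i)" if "i \<in> I" for i
    using ag[OF that] by (rule abelian_group.axioms)
  have smult: "c \<odot>\<^bsub>W\<^esub> y \<in> carrier W" if "c \<in> K" "y \<in> carrier W" for c y
    using W_smult(1) that by blast
  have m1: "- 1 \<in> K" using scalars by auto
  have "abelian_group W"
  proof (rule abelian_groupI)
    fix x y z assume x: "x \<in> carrier W" and y: "y \<in> carrier W"
    show "x \<oplus>\<^bsub>W\<^esub> y \<in> carrier W" by (rule W_add(1)[OF x y])
    show "x \<oplus>\<^bsub>W\<^esub> y = y \<oplus>\<^bsub>W\<^esub> x"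
      unfolding W_simps(2) using am comp[OF x] comp[OF y]
      by (intro restrict_ext) (auto intro: abelian_monoid.a_comm)
    show "x \<oplus>\<^bsub>W\<^esub> y \<oplus>\<^bsub>W\<^esub> z = x \<oplus>\<^bsub>W\<^esub> (y \<oplus>\<^bsub>W\<^esub> z)" if z: "z \<in> carrier W"
      unfolding W_simps(2) using am comp[OF x] comp[OF y] comp[OF z]
      by (intro restrict_ext) (auto intro: abelian_monoid.a_assoc)
  next
    show "\<zero>\<^bsub>W\<^esub> \<in> carrier W" by (rule W_zero)
  next
    fix x assume x: "x \<in> carrier W"
    show "\<zero>\<^bsub>W\<^esub> \<oplus>\<^bsub>W\<^esub> x = x"
      using am comp[OF x] x
      by (intro W_ext W_extensional W_add W_zero) (auto simp: W_simps(2,4) intro: abelian_monoid.l_zero)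
    have "(- 1) \<odot>\<^bsub>W\<^esub> x \<oplus>\<^bsub>W\<^esub> x = \<zero>\<^bsub>W\<^esub>"
    proof (intro W_ext W_extensional W_add W_zero smult m1 x)
      fix i assume i: "i \<in> I"
      interpret Yi: normed_vector_space K "Y i" by (rule Y[OF i])
      show "((- 1) \<odot>\<^bsub>W\<^esub> x \<oplus>\<^bsub>W\<^esub> x) i = \<zero>\<^bsub>W\<^esub> i"
        using comp[OF x i] i by (simp add: W_simps(2,3,4) Yi.K_minus_one Yi.M.l_neg)
    qed
    then show "\<exists>y\<in>carrier W. y \<oplus>\<^bsub>W\<^esub> x = \<zero>\<^bsub>W\<^esub>"
      using smult[OF m1 x] by blast
  qed
  then show "Module.module (scalar_field K) W"
  proof (rule moduleI[OF cring_scalar_field[OF scalars]])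
    fix a b x y
    assume a: "a \<in> carrier (scalar_field K)" and x: "x \<in> carrier W"
    then have aK: "a \<in> K" by (simp add: scalar_field_def)
    show "a \<odot>\<^bsub>W\<^esub> x \<in> carrier W" by (rule smult[OF aK x])
    show "a \<odot>\<^bsub>W\<^esub> (x \<oplus>\<^bsub>W\<^esub> y) = a \<odot>\<^bsub>W\<^esub> x \<oplus>\<^bsub>W\<^esub> a \<odot>\<^bsub>W\<^esub> y" if y: "y \<in> carrier W"
      unfolding W_simps(2,3) using ms a comp[OF x] comp[OF y]
      by (intro restrict_ext) (auto intro: Module.module.smult_r_distr)
    assume b: "b \<in> carrier (scalar_field K)"
    show "(a \<oplus>\<^bsub>scalar_field K\<^esub> b) \<odot>\<^bsub>W\<^esub> x = a \<odot>\<^bsub>W\<^esub> x \<oplus>\<^bsub>W\<^esub> b \<odot>\<^bsub>W\<^esub> x"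
      unfolding W_simps(2,3) using ms a b comp[OF x]
      by (intro restrict_ext) (auto intro: Module.module.smult_l_distr)
    show "(a \<otimes>\<^bsub>scalar_field K\<^esub> b) \<odot>\<^bsub>W\<^esub> x = a \<odot>\<^bsub>W\<^esub> (b \<odot>\<^bsub>W\<^esub> x)"
      unfolding W_simps(3) using ms a b comp[OF x]
      by (intro restrict_ext) (auto intro: Module.module.smult_assoc1)
  next
    fix x assume x: "x \<in> carrier W"
    have one: "1 \<in> K" using scalars by auto
    have "1 \<odot>\<^bsub>W\<^esub> x = x"
    proof (intro W_ext W_extensional smult one x)
      fix i assume i: "i \<in> I"
      interpret Yi: normed_vector_space K "Y i" by (rule Y[OF i])
      show "(1 \<odot>\<^bsub>W\<^esub> x) i = x i"
        using comp[OF x i] i by (simp add: W_simps(3) Yi.K_smult(4))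
    qed
    then show "\<one>\<^bsub>scalar_field K\<^esub> \<odot>\<^bsub>W\<^esub> x = x" by (simp add: scalar_field_def)
  qed
  fix x assume x: "x \<in> carrier W"
  show "nrm W x = 0 \<longleftrightarrow> x = \<zero>\<^bsub>W\<^esub>"
  proof
    assume 0: "nrm W x = 0"
    show "x = \<zero>\<^bsub>W\<^esub>"
    proof (intro W_ext W_extensional x W_zero)
      fix i assume i: "i \<in> I"
      interpret Yi: normed_vector_space K "Y i" by (rule Y[OF i])
      have "nrm (Y i) (x i) = 0"
        using lnorm_le_nrm[OF x, of "{i}"] i 0 p comp[OF x i] Yi.nrm_nonneg[of "x i"]
        by (simp add: lnorm_def powr_powr)
      then show "x i = \<zero>\<^bsub>W\<^esub> i"
        using i comp[OF x i] by (simp add: Yi.nrm_eq_zero W_simps(4))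
    qed
  qed (simp add: W_zero)
  show "nrm W (x \<oplus>\<^bsub>W\<^esub> y) \<le> nrm W x + nrm W y" if "y \<in> carrier W" for y
    by (rule W_add(2)[OF x that])
  show "nrm W (c \<odot>\<^bsub>W\<^esub> x) = norm c * nrm W x" if "c \<in> K" for c
    by (rule W_smult(2)[OF x that])
qed

definition cut :: "'i set \<Rightarrow> ('i \<Rightarrow> 'b) \<Rightarrow> 'i \<Rightarrow> 'b" where
  "cut J y = (\<lambda>i\<in>I. if i \<in> J then y i else \<zero>\<^bsub>Y i\<^esub>)"

lemma zero_Y: "i \<in> I \<Longrightarrow> \<zero>\<^bsub>Y i\<^esub> \<in> carrier (Y i) \<and> nrm (Y i) \<zero>\<^bsub>Y i\<^esub> = 0"
  using W_zero W_component[OF W_zero(1), of i] Y[of i, THEN normed_vector_space.nrm_zero]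
  by (simp add: W_simps(4))

lemma
  assumes y: "y \<in> (\<Pi> i\<in>I. carrier (Y i))"
    and M: "\<And>J'. \<lbrakk>finite J'; J' \<subseteq> I \<inter> J\<rbrakk> \<Longrightarrow> lnorm p J' (\<lambda>i. nrm (Y i) (y i)) \<le> M"
  shows cut_mem: "cut J y \<in> carrier W" and nrm_cut_le: "nrm W (cut J y) \<le> M"
proof -
  have mem: "cut J y \<in> (\<Pi>\<^sub>E i\<in>I. carrier (Y i))"
    using y zero_Y by (auto simp: cut_def)
  have le: "lnorm p J' (\<lambda>i. nrm (Y i) (cut J y i)) \<le> M" if J': "finite J'" "J' \<subseteq> I" for J'
  proof -
    have "(\<Sum>i\<in>J'. nrm (Y i) (cut J y i) powr p) = (\<Sum>i\<in>J' \<inter> J. nrm (Y i) (y i) powr p)"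
      using J' p zero_Y by (intro sum.mono_neutral_cong_right) (auto simp: cut_def)
    then show ?thesis
      using M[of "J' \<inter> J"] J' by (auto simp: lnorm_def)
  qed
  show "cut J y \<in> carrier W"
    by (rule W_memI[OF mem le])
  show "nrm W (cut J y) \<le> M"
    by (rule nrm_W_le[OF mem le])
qed

lemma cut_carrier: "y \<in> carrier W \<Longrightarrow> cut J y \<in> carrier W"
  using W_component lnorm_le_nrm by (intro cut_mem[where M="nrm W y"]) auto

lemma cut_Un:
  assumes "y \<in> (\<Pi> i\<in>I. carrier (Y i))" "J \<inter> J' = {}"
  shows "cut (J \<union> J') y = cut J y \<oplus>\<^bsub>W\<^esub> cut J' y"
  unfolding cut_def W_simps(2)
proof (rule restrict_ext)
  fix i assume i: "i \<in> I"
  interpret Yi: normed_vector_space K "Y i" by (rule Y[OF i])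
  show "(if i \<in> J \<union> J' then y i else \<zero>\<^bsub>Y i\<^esub>) =
    (\<lambda>i\<in>I. if i \<in> J then y i else \<zero>\<^bsub>Y i\<^esub>) i \<oplus>\<^bsub>Y i\<^esub> (\<lambda>i\<in>I. if i \<in> J' then y i else \<zero>\<^bsub>Y i\<^esub>) i"
    using assms i by (auto simp: Pi_iff)
qed

definition single :: "'i \<Rightarrow> 'b \<Rightarrow> 'i \<Rightarrow> 'b" where
  "single i z = (\<lambda>j\<in>I. if j = i then z else \<zero>\<^bsub>Y j\<^esub>)"

lemma single_mem:
  assumes "i \<in> I" "z \<in> carrier (Y i)"
  shows "single i z \<in> carrier W" and "nrm W (single i z) \<le> nrm (Y i) z"
proof -
  have eq: "single i z = cut {i} (\<lambda>j. if j = i then z else \<zero>\<^bsub>Y j\<^esub>)"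
    by (simp add: single_def cut_def cong: if_cong)
  have "lnorm p J' (\<lambda>j. nrm (Y j) (if j = i then z else \<zero>\<^bsub>Y j\<^esub>)) \<le> nrm (Y i) z"
    if "finite J'" "J' \<subseteq> I \<inter> {i}" for J'
  proof -
    from that consider "J' = {}" | "J' = {i}" by blast
    then show ?thesis
      using assms p nrm_Y_nonneg[OF assms] by cases (simp_all add: lnorm_def powr_powr)
  qed
  then show "single i z \<in> carrier W" "nrm W (single i z) \<le> nrm (Y i) z"
    unfolding eq using assms zero_Y by (auto intro!: cut_mem nrm_cut_le)
qed

lemma single_linear:
  assumes i: "i \<in> I"
  shows "linear_map K (Y i) W (single i)"
  unfolding linear_map_def
proof (intro conjI ballI)
  show "single i \<in> carrier (Y i) \<rightarrow> carrier W" using single_mem i by auto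
  show "single i (x \<oplus>\<^bsub>Y i\<^esub> y) = single i x \<oplus>\<^bsub>W\<^esub> single i y" for x y
    unfolding single_def W_simps(2)
  proof (rule restrict_ext)
    fix j assume j: "j \<in> I"
    interpret Yj: normed_vector_space K "Y j" by (rule Y[OF j])
    show "(if j = i then x \<oplus>\<^bsub>Y i\<^esub> y else \<zero>\<^bsub>Y j\<^esub>) = (\<lambda>j\<in>I. if j = i then x else \<zero>\<^bsub>Y j\<^esub>) j
        \<oplus>\<^bsub>Y j\<^esub> (\<lambda>j\<in>I. if j = i then y else \<zero>\<^bsub>Y j\<^esub>) j"
      using j by auto
  qed
  show "single i (c \<odot>\<^bsub>Y i\<^esub> x) = c \<odot>\<^bsub>W\<^esub> single i x" if "c \<in> K" for c x
    unfolding single_def W_simps(3)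
  proof (rule restrict_ext)
    fix j assume j: "j \<in> I"
    interpret Yj: normed_vector_space K "Y j" by (rule Y[OF j])
    show "(if j = i then c \<odot>\<^bsub>Y i\<^esub> x else \<zero>\<^bsub>Y j\<^esub>) = c \<odot>\<^bsub>Y j\<^esub> (\<lambda>j\<in>I. if j = i then x else \<zero>\<^bsub>Y j\<^esub>) j"
      using j that by (auto simp: Yj.K_smult_zero)
  qed
qed

text \<open>
  The half of the duality of \<open>\<ell>\<^sup>p\<close> sums that is used here: a bounded functional is the sum of its
  components, because the cut-offs of a vector converge to it in norm.
\<close>

lemma
  assumes \<phi>: "linear_map K W (scalar_field K) \<phi>"
    and c: "\<And>y. y \<in> carrier W \<Longrightarrow> norm (\<phi> y) \<le> c * nrm W y" and "0 \<le> c"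
  shows component_dual: "i \<in> I \<Longrightarrow> (\<lambda>z. \<phi> (single i z)) \<in> dual K (Y i)"
    and has_sum_components: "y \<in> carrier W \<Longrightarrow> ((\<lambda>i. \<phi> (single i (y i))) has_sum \<phi> y) I"
    and sum_components: "\<lbrakk>y \<in> carrier W; finite J; J \<subseteq> I\<rbrakk> \<Longrightarrow> (\<Sum>i\<in>J. \<phi> (single i (y i))) = \<phi> (cut J y)"
proof -
  interpret W: normed_vector_space K W by (rule normed_W)
  have \<phi>_dual: "\<phi> \<in> dual K W" by (rule W.dualI[OF \<phi> c])
  note \<phi>_add = W.dual_D(1)[OF \<phi>_dual]
  show "(\<lambda>z. \<phi> (single i z)) \<in> dual K (Y i)" if i: "i \<in> I"
  proof (rule normed_vector_space.dualI[OF Y[OF i]])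
    show "linear_map K (Y i) (scalar_field K) (\<lambda>z. \<phi> (single i z))"
      using \<phi> single_linear[OF i] by (auto simp: linear_map_def Pi_iff)
    show "norm (\<phi> (single i z)) \<le> c * nrm (Y i) z" if z: "z \<in> carrier (Y i)" for z
      using c[OF single_mem(1)[OF i z]] mult_left_mono[OF single_mem(2)[OF i z] \<open>0 \<le> c\<close>] by linarith
  qed
  show fin: "(\<Sum>i\<in>J. \<phi> (single i (y i))) = \<phi> (cut J y)"
    if y: "y \<in> carrier W" and "finite J" "J \<subseteq> I" for y J
    using that(2,3)
  proof (induction J rule: finite_induct)
    case empty
    have "cut {} y = \<zero>\<^bsub>W\<^esub>" by (simp add: cut_def W_simps(4))
    then show ?case using c[OF W_zero(1)] W_zero(2) by simp
  next
    case (insert i J)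
    have "cut {i} y = single i (y i)" by (auto simp: cut_def single_def intro!: restrict_ext)
    then have "cut (insert i J) y = single i (y i) \<oplus>\<^bsub>W\<^esub> cut J y"
      using cut_Un[of y "{i}" J] insert W_component[OF y] by auto
    then show ?case
      using insert \<phi>_add[OF single_mem(1) cut_carrier[OF y]] W_component[OF y] by simp
  qed
  show "((\<lambda>i. \<phi> (single i (y i))) has_sum \<phi> y) I" if y: "y \<in> carrier W" for y
  proof -
    let ?a = "\<lambda>i. nrm (Y i) (y i) powr p"
    have sm: "?a summable_on I" using y by (simp add: W_simps)
    have yPi: "y \<in> (\<Pi> i\<in>I. carrier (Y i))" using W_component[OF y] by auto
    have le: "norm ((\<Sum>i\<in>J. \<phi> (single i (y i))) - \<phi> y) \<le> c * (infsum ?a I - sum ?a J) powr (1 / p)"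
      if J: "finite J" "J \<subseteq> I" for J
    proof -
      have "cut (J \<union> - J) y = y"
        using y by (intro W_ext W_extensional cut_carrier) (auto simp: cut_def)
      then have "\<phi> y = \<phi> (cut J y) + \<phi> (cut (- J) y)"
        using cut_Un[OF yPi, of J "- J"] \<phi>_add[OF cut_carrier[OF y] cut_carrier[OF y], of J "- J"] by simp
      then have "norm ((\<Sum>i\<in>J. \<phi> (single i (y i))) - \<phi> y) = norm (\<phi> (cut (- J) y))"
        using fin[OF y J] by simp
      also have "\<dots> \<le> c * nrm W (cut (- J) y)" by (rule c[OF cut_carrier[OF y]])
      also have "nrm W (cut (- J) y) \<le> (infsum ?a I - sum ?a J) powr (1 / p)"
      proof (rule nrm_cut_le[OF yPi])
        fix J' assume "finite J'" "J' \<subseteq> I \<inter> - J"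
        then have "sum ?a J' \<le> infsum ?a I - sum ?a J"
          by (intro disjoint_sum_le_tail sm J) auto
        then show "lnorm p J' (\<lambda>i. nrm (Y i) (y i)) \<le> (infsum ?a I - sum ?a J) powr (1 / p)"
          unfolding lnorm_def using p by (intro powr_mono2 sum_nonneg) auto
      qed
      finally show ?thesis using \<open>0 \<le> c\<close> by (simp add: mult_left_mono)
    qed
    have "((\<lambda>J. (infsum ?a I - sum ?a J) powr (1 / p)) \<longlongrightarrow> 0) (finite_subsets_at_top I)"
      by (rule tail_powr_tendsto_0[OF sm]) (use p in simp_all)
    then have lim: "((\<lambda>J. c * (infsum ?a I - sum ?a J) powr (1 / p)) \<longlongrightarrow> 0) (finite_subsets_at_top I)"
      by (rule tendsto_mult_right_zero)
    have "((\<lambda>J. (\<Sum>i\<in>J. \<phi> (single i (y i))) - \<phi> y) \<longlongrightarrow> 0) (finite_subsets_at_top I)"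
      by (rule Lim_null_comparison[OF eventually_finite_subsets_at_top_weakI lim]) (rule le)
    then have "((\<lambda>J. \<Sum>i\<in>J. \<phi> (single i (y i))) \<longlongrightarrow> \<phi> y) (finite_subsets_at_top I)"
      by (rule LIM_zero_cancel)
    then show ?thesis unfolding has_sum_def .
  qed
qed

end

section \<open>Analysis operators\<close>

text \<open>
  The operators \<open>T i\<close> stand for \<open>v\<^sub>i \<Lambda>\<^sub>i P\<^sub>i\<close>. The functionals \<open>f \<mapsto> \<Sum>i\<in>J. g i (T i f)\<close> form the image of the
  finite family \<open>g\<close> under the adjoint of \<open>f \<mapsto> (T i f)\<^sub>i\<close>.
\<close>

locale riesz_family = lp_family K p q I Y
  for K :: "complex set" and p q :: real and I :: "'i set"
    and Y :: "'i \<Rightarrow> (complex, 'b) normed_module" +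
  fixes X :: "(complex, 'a) normed_module" and T :: "'i \<Rightarrow> 'a \<Rightarrow> 'b" and A B :: real
  assumes X: "banach_space K X"
    and A: "0 < A" and AB: "A \<le> B"
    and T: "\<And>i. i \<in> I \<Longrightarrow> linear_map K X (Y i) (T i)"
    and T_inj: "\<And>x. \<lbrakk>x \<in> carrier X; \<And>i. i \<in> I \<Longrightarrow> T i x = \<zero>\<^bsub>Y i\<^esub>\<rbrakk> \<Longrightarrow> x = \<zero>\<^bsub>X\<^esub>"
    and synthesis_dual: "\<And>J g. \<lbrakk>finite J; J \<subseteq> I; \<And>i. i \<in> J \<Longrightarrow> g i \<in> dual K (Y i)\<rbrakk> \<Longrightarrow>
      (\<lambda>f. \<Sum>i\<in>J. g i (T i f)) \<in> dual K X"
    and synthesis_lower: "\<And>J g. \<lbrakk>finite J; J \<subseteq> I; \<And>i. i \<in> J \<Longrightarrow> g i \<in> dual K (Y i)\<rbrakk> \<Longrightarrow>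
      A * lnorm q J (\<lambda>i. dual_norm (Y i) (g i)) \<le> dual_norm X (\<lambda>f. \<Sum>i\<in>J. g i (T i f))"
    and synthesis_upper: "\<And>J g. \<lbrakk>finite J; J \<subseteq> I; \<And>i. i \<in> J \<Longrightarrow> g i \<in> dual K (Y i)\<rbrakk> \<Longrightarrow>
      dual_norm X (\<lambda>f. \<Sum>i\<in>J. g i (T i f)) \<le> B * lnorm q J (\<lambda>i. dual_norm (Y i) (g i))"

sublocale riesz_family \<subseteq> X: normed_vector_space K X
  by (intro normed_vector_space.intro normed_vector_space_axioms.intro scalars
      banach_space.axioms(1)[OF X])

sublocale riesz_family \<subseteq> W: normed_vector_space K "lp_sum p I Y"
  by (rule normed_W)

context riesz_family
begin

lemma T_closed: "\<lbrakk>i \<in> I; f \<in> carrier X\<rbrakk> \<Longrightarrow> T i f \<in> carrier (Y i)"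
  using T[of i] by (auto simp: linear_map_def)

text \<open>
  The upper bound is inherited by duality from the finite families \<open>g\<close>: take for \<open>g i\<close> a functional
  of norm at most \<open>a i powr (p - 1)\<close> that maps \<open>T i f\<close> to \<open>a i powr p\<close>, where \<open>a i\<close> is the norm of \<open>T i f\<close>. This is the
  equality case of Hoelder's inequality.
\<close>

lemma analysis_upper:
  assumes J: "finite J" "J \<subseteq> I" and f: "f \<in> carrier X"
  shows "lnorm p J (\<lambda>i. nrm (Y i) (T i f)) \<le> B * nrm X f"
proof -
  define a where "a i = nrm (Y i) (T i f)" for i
  define Z where "Z = (\<Sum>i\<in>J. a i powr p)"
  have a: "0 \<le> a i" if "i \<in> J" for i
    using that J nrm_Y_nonneg[OF _ T_closed[OF _ f]] by (auto simp: a_def)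
  have "\<exists>g. g \<in> dual K (Y i) \<and> dual_norm (Y i) g \<le> a i powr (p - 1) \<and>
      g (T i f) = of_real (a i powr (p - 1) * a i)" if "i \<in> J" for i
    using that J normed_vector_space.norming_functional[OF Y T_closed[OF _ f], of i "a i powr (p - 1)"]
    unfolding a_def by (metis powr_ge_zero subsetD)
  then obtain g where g: "\<And>i. i \<in> J \<Longrightarrow> g i \<in> dual K (Y i)"
    and g_norm: "\<And>i. i \<in> J \<Longrightarrow> dual_norm (Y i) (g i) \<le> a i powr (p - 1)"
    and g_val: "\<And>i. i \<in> J \<Longrightarrow> g i (T i f) = of_real (a i powr (p - 1) * a i)"
    by metis
  have g_val': "g i (T i f) = of_real (a i powr p)" if "i \<in> J" for i
    using g_val[OF that] powr_mult_base[OF a[OF that], of "p - 1"] by (simp add: mult.commute)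
  have "(p - 1) * q = p" using p q pq by (simp add: field_simps)
  then have "lnorm q J (\<lambda>i. a i powr (p - 1)) = Z powr (1 / q)"
    by (simp add: lnorm_def powr_powr Z_def)
  moreover have "lnorm q J (\<lambda>i. dual_norm (Y i) (g i)) \<le> lnorm q J (\<lambda>i. a i powr (p - 1))"
  proof (rule lnorm_mono)
    fix i assume i: "i \<in> J"
    with J have "i \<in> I" by auto
    from normed_vector_space.dual_norm_nonneg[OF Y[OF this] g[OF i]] g_norm[OF i]
    show "0 \<le> dual_norm (Y i) (g i) \<and> dual_norm (Y i) (g i) \<le> a i powr (p - 1)" ..
  qed (use q J in auto)
  ultimately have gZ: "lnorm q J (\<lambda>i. dual_norm (Y i) (g i)) \<le> Z powr (1 / q)" by simp
  have "Z = norm (\<Sum>i\<in>J. g i (T i f))"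
    using g_val' by (simp add: Z_def sum_nonneg flip: of_real_sum)
  also have "\<dots> \<le> dual_norm X (\<lambda>f. \<Sum>i\<in>J. g i (T i f)) * nrm X f"
    by (rule X.norm_le_dual_norm[OF synthesis_dual[OF J g] f])
  also have "\<dots> \<le> (B * lnorm q J (\<lambda>i. dual_norm (Y i) (g i))) * nrm X f"
    by (intro mult_right_mono synthesis_upper J g X.nrm_nonneg f)
  also have "\<dots> \<le> (B * Z powr (1 / q)) * nrm X f"
    using A AB gZ f by (intro mult_right_mono mult_left_mono X.nrm_nonneg) auto
  finally have "Z \<le> (B * nrm X f) * Z powr (1 / q)" by (simp add: mult_ac)
  then have "Z powr (1 / p) \<le> B * nrm X f"
    using A AB X.nrm_nonneg[OF f] by (intro dual_exponent_bound[OF p pq]) (auto simp: Z_def sum_nonneg)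
  then show ?thesis by (simp add: lnorm_def Z_def a_def)
qed

text \<open>
  The analysis operator of the family.
\<close>

definition U :: "'a \<Rightarrow> 'i \<Rightarrow> 'b" where
  "U f = (\<lambda>i\<in>I. T i f)"

lemma
  assumes f: "f \<in> carrier X"
  shows U_mem: "U f \<in> carrier W" and nrm_U_le: "nrm W (U f) \<le> B * nrm X f"
proof -
  have 1: "U f \<in> (\<Pi>\<^sub>E i\<in>I. carrier (Y i))"
    using T_closed[OF _ f] by (auto simp: U_def)
  have 2: "lnorm p J (\<lambda>i. nrm (Y i) (U f i)) \<le> B * nrm X f" if J: "finite J" "J \<subseteq> I" for J
  proof -
    have "lnorm p J (\<lambda>i. nrm (Y i) (U f i)) = lnorm p J (\<lambda>i. nrm (Y i) (T i f))"
      unfolding lnorm_def using J by (intro arg_cong[where f="\<lambda>s. s powr (1 / p)"] sum.cong) (auto simp: U_def)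
    with analysis_upper[OF J f] show ?thesis by simp
  qed
  show "U f \<in> carrier W" by (rule W_memI[OF 1 2])
  show "nrm W (U f) \<le> B * nrm X f" by (rule nrm_W_le[OF 1 2])
qed

lemma U_linear: "linear_map K X W U"
  unfolding linear_map_def
proof (intro conjI ballI)
  show "U \<in> carrier X \<rightarrow> carrier W" using U_mem by auto
  show "U (x \<oplus>\<^bsub>X\<^esub> y) = U x \<oplus>\<^bsub>W\<^esub> U y" if "x \<in> carrier X" "y \<in> carrier X" for x y
    using that T unfolding U_def W_simps(2) by (intro restrict_ext) (simp add: linear_map_def)
  show "U (c \<odot>\<^bsub>X\<^esub> x) = c \<odot>\<^bsub>W\<^esub> U x" if "c \<in> K" "x \<in> carrier X" for c x
    using that T unfolding U_def W_simps(3) by (intro restrict_ext) (simp add: linear_map_def)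
qed

lemma U_add: "\<lbrakk>x \<in> carrier X; y \<in> carrier X\<rbrakk> \<Longrightarrow> U (x \<oplus>\<^bsub>X\<^esub> y) = U x \<oplus>\<^bsub>W\<^esub> U y"
  and U_smult: "\<lbrakk>c \<in> K; x \<in> carrier X\<rbrakk> \<Longrightarrow> U (c \<odot>\<^bsub>X\<^esub> x) = c \<odot>\<^bsub>W\<^esub> U x"
  using U_linear by (auto simp: linear_map_def)

text \<open>
  Let \<open>g i\<close> be the components of \<open>\<phi>\<close>. If the lower Riesz bound could be applied to the whole family
  \<open>g\<close>, it would give \<open>A * \<parallel>g\<parallel> \<le> \<parallel>\<phi> \<circ> U\<parallel> \<le> 1\<close> and Hoelder's inequality would finish the proof. It is only
  available for a finite \<open>J\<close>, where the functional differs from \<open>\<phi> \<circ> U\<close> by the components outside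
  \<open>J\<close>. The upper Riesz bound controls these by the tail of \<open>\<Sum>\<parallel>g i\<parallel>\<^sup>q\<close>, which tends to \<open>0\<close>. That this
  series converges follows from the lower bound and the crude estimate by \<open>c * B\<close>, whatever
  the size of \<open>c\<close>.
\<close>

lemma functional_bound:
  assumes \<phi>: "linear_map K W (scalar_field K) \<phi>"
    and \<phi>_c: "\<And>y. y \<in> carrier W \<Longrightarrow> norm (\<phi> y) \<le> c * nrm W y" and c: "0 \<le> c"
    and \<phi>_U: "\<And>f. f \<in> carrier X \<Longrightarrow> norm (\<phi> (U f)) \<le> nrm X f"
    and y: "y \<in> carrier W"
  shows "norm (\<phi> y) \<le> nrm W y / A"
proof -
  define g where "g i z = \<phi> (single i z)" for i z
  define b where "b i = dual_norm (Y i) (g i)" for i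
  note F = finite_subsets_at_top_neq_bot
  have g: "g i \<in> dual K (Y i)" if "i \<in> I" for i
    unfolding g_def by (rule component_dual[OF \<phi> \<phi>_c c that])
  have b: "0 \<le> b i" if "i \<in> I" for i
    using normed_vector_space.dual_norm_nonneg[OF Y g] that by (simp add: b_def)
  have hs: "((\<lambda>i. g i (w i)) has_sum \<phi> w) I" if "w \<in> carrier W" for w
    unfolding g_def by (rule has_sum_components[OF \<phi> \<phi>_c c that])
  have gU: "g i (U f i) = g i (T i f)" if "i \<in> I" for i f using that by (simp add: U_def)
  have unit: "B * nrm X f \<le> B" if "nrm X f \<le> 1" for f
    using that A AB mult_left_mono[of "nrm X f" 1 B] by simp

  have bounded: "A * lnorm q J b \<le> c * B" if J: "finite J" "J \<subseteq> I" for J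
  proof -
    have "A * lnorm q J b \<le> dual_norm X (\<lambda>f. \<Sum>i\<in>J. g i (T i f))"
      unfolding b_def using J g by (intro synthesis_lower) auto
    also have "\<dots> \<le> c * B"
    proof (rule X.dual_norm_le)
      fix f assume f: "f \<in> carrier X" "nrm X f \<le> 1"
      have "(\<Sum>i\<in>J. g i (T i f)) = (\<Sum>i\<in>J. \<phi> (single i (U f i)))"
        using J gU by (intro sum.cong) (auto simp: g_def)
      also have "\<dots> = \<phi> (cut J (U f))"
        by (rule sum_components[OF \<phi> \<phi>_c c U_mem[OF f(1)] J])
      finally have "norm (\<Sum>i\<in>J. g i (T i f)) \<le> c * nrm W (cut J (U f))"
        using \<phi>_c[OF cut_carrier[OF U_mem[OF f(1)]]] by simp
      also have "nrm W (cut J (U f)) \<le> nrm W (U f)"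
      proof (rule nrm_cut_le)
        show "U f \<in> (\<Pi> i\<in>I. carrier (Y i))" using W_component[OF U_mem[OF f(1)]] by auto
      qed (use lnorm_le_nrm[OF U_mem[OF f(1)]] in auto)
      also have "nrm W (U f) \<le> B" using nrm_U_le[OF f(1)] unit[OF f(2)] by simp
      finally show "norm (\<Sum>i\<in>J. g i (T i f)) \<le> c * B" using c by (simp add: mult_left_mono)
    qed
    finally show ?thesis .
  qed
  have "(\<Sum>i\<in>J. b i powr q) \<le> (c * B / A) powr q" if J: "finite J" "J \<subseteq> I" for J
  proof -
    have "lnorm q J b \<le> c * B / A" using bounded[OF J] A by (simp add: field_simps)
    then have "lnorm q J b powr q \<le> (c * B / A) powr q"
      using q by (intro powr_mono2 lnorm_nonneg) auto
    then show ?thesis using q by (simp add: lnorm_powr)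
  qed
  then have sm: "(\<lambda>i. b i powr q) summable_on I"
    by (intro nonneg_bdd_above_summable_on bdd_aboveI2[where M="(c * B / A) powr q"]) auto
  define S where "S = (\<Sum>\<^sub>\<infinity>i\<in>I. b i powr q)"

  have lower: "A * lnorm q J b \<le> 1 + B * (S - (\<Sum>i\<in>J. b i powr q)) powr (1 / q)"
    if J: "finite J" "J \<subseteq> I" for J
  proof -
    define R where "R = B * (S - (\<Sum>i\<in>J. b i powr q)) powr (1 / q)"
    have "A * lnorm q J b \<le> dual_norm X (\<lambda>f. \<Sum>i\<in>J. g i (T i f))"
      unfolding b_def using J g by (intro synthesis_lower) auto
    also have "\<dots> \<le> 1 + R"
    proof (rule X.dual_norm_le)
      fix f assume f: "f \<in> carrier X" "nrm X f \<le> 1"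
      let ?s = "\<lambda>J. \<Sum>i\<in>J. g i (T i f)"
      have "((\<lambda>i. g i (U f i)) has_sum \<phi> (U f)) I \<longleftrightarrow> ((\<lambda>i. g i (T i f)) has_sum \<phi> (U f)) I"
        by (intro has_sum_cong gU)
      with hs[OF U_mem[OF f(1)]] have "(?s \<longlongrightarrow> \<phi> (U f)) (finite_subsets_at_top I)"
        by (simp add: has_sum_def)
      then have "((\<lambda>J'. norm (?s J' - ?s J)) \<longlongrightarrow> norm (\<phi> (U f) - ?s J)) (finite_subsets_at_top I)"
        by (intro tendsto_intros)
      moreover have "\<forall>\<^sub>F J' in finite_subsets_at_top I. norm (?s J' - ?s J) \<le> R"
        unfolding eventually_finite_subsets_at_top
      proof (intro exI[of _ J] conjI J allI impI)
        fix J' assume J': "finite J' \<and> J \<subseteq> J' \<and> J' \<subseteq> I"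
        then have D: "finite (J' - J)" "J' - J \<subseteq> I" by auto
        have "norm (?s J' - ?s J) = norm (?s (J' - J))"
          using J' by (simp add: sum_diff)
        also have "\<dots> \<le> dual_norm X (\<lambda>f. \<Sum>i\<in>J' - J. g i (T i f)) * nrm X f"
          using g D by (intro X.norm_le_dual_norm synthesis_dual f(1)) auto
        also have "\<dots> \<le> (B * lnorm q (J' - J) b) * nrm X f"
          unfolding b_def using g D by (intro mult_right_mono synthesis_upper X.nrm_nonneg f(1)) auto
        also have "\<dots> \<le> (B * lnorm q (J' - J) b) * 1"
          using A AB f(2) by (intro mult_left_mono mult_nonneg_nonneg lnorm_nonneg) auto
        also have "\<dots> \<le> R"
        proof -
          have "(\<Sum>i\<in>J' - J. b i powr q) \<le> S - (\<Sum>i\<in>J. b i powr q)"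
            unfolding S_def using D J by (intro disjoint_sum_le_tail sm) auto
          then show ?thesis
            unfolding R_def lnorm_def using A AB q by (auto intro!: mult_left_mono powr_mono2 sum_nonneg)
        qed
        finally show "norm (?s J' - ?s J) \<le> R" .
      qed
      ultimately have "norm (\<phi> (U f) - ?s J) \<le> R"
        by (rule tendsto_upperbound) simp
      moreover have "norm (\<phi> (U f)) \<le> 1" using \<phi>_U[OF f(1)] f(2) by simp
      ultimately show "norm (?s J) \<le> 1 + R"
        using norm_triangle_ineq4[of "\<phi> (U f)" "\<phi> (U f) - ?s J"] by simp
    qed
    finally show ?thesis by (simp add: R_def)
  qed
  have lim: "((\<lambda>J. lnorm q J b) \<longlongrightarrow> S powr (1 / q)) (finite_subsets_at_top I)"
    unfolding lnorm_def S_def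
    by (rule tendsto_powr'[OF infsum_tendsto[OF sm] tendsto_const])
      (use q in \<open>auto intro!: eventually_finite_subsets_at_top_weakI sum_nonneg\<close>)
  have "((\<lambda>J. B * (S - (\<Sum>i\<in>J. b i powr q)) powr (1 / q)) \<longlongrightarrow> 0) (finite_subsets_at_top I)"
    unfolding S_def by (intro tendsto_mult_right_zero tail_powr_tendsto_0[OF sm]) (use q in simp_all)
  from tendsto_add[OF tendsto_const this]
  have lim_upper: "((\<lambda>J. 1 + B * (S - (\<Sum>i\<in>J. b i powr q)) powr (1 / q)) \<longlongrightarrow> 1 + 0)
      (finite_subsets_at_top I)" .
  have "A * S powr (1 / q) \<le> 1 + 0"
    by (rule tendsto_le[OF F lim_upper tendsto_mult_left[OF lim, of A]])
      (intro eventually_finite_subsets_at_top_weakI lower)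
  then have S: "S powr (1 / q) \<le> 1 / A" using A by (simp add: field_simps)

  have fin: "norm (\<Sum>i\<in>J. g i (y i)) \<le> S powr (1 / q) * nrm W y" if J: "finite J" "J \<subseteq> I" for J
  proof -
    have "norm (\<Sum>i\<in>J. g i (y i)) \<le> (\<Sum>i\<in>J. b i * nrm (Y i) (y i))"
      using J W_component[OF y] g Y unfolding b_def
      by (intro sum_norm_le normed_vector_space.norm_le_dual_norm) auto
    also have "\<dots> \<le> lnorm q J b * lnorm p J (\<lambda>i. nrm (Y i) (y i))"
      using p q pq J b W_component[OF y] by (intro Hoelder_sum) (auto intro: nrm_Y_nonneg)
    also have "\<dots> \<le> S powr (1 / q) * nrm W y"
    proof (intro mult_mono lnorm_le_nrm y J lnorm_nonneg)
      show "lnorm q J b \<le> S powr (1 / q)"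
        unfolding lnorm_def S_def using J q
        by (intro powr_mono2 finite_sum_le_infsum sm sum_nonneg) auto
    qed simp
    finally show ?thesis .
  qed
  have "((\<lambda>J. norm (\<Sum>i\<in>J. g i (y i))) \<longlongrightarrow> norm (\<phi> y)) (finite_subsets_at_top I)"
    using hs[OF y] unfolding has_sum_def by (rule tendsto_norm)
  then have "norm (\<phi> y) \<le> S powr (1 / q) * nrm W y"
    by (rule tendsto_upperbound) (use fin in \<open>auto intro: eventually_finite_subsets_at_top_weakI\<close>)
  also have "\<dots> \<le> (1 / A) * nrm W y"
    by (intro mult_right_mono S W.nrm_nonneg y)
  finally show ?thesis by simp
qed

text \<open>
  This seminorm on the \<open>\<ell>\<^sup>p\<close> sum measures how well \<open>y\<close> is approximated by images under \<open>U\<close> of short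
  vectors. A functional bounded by it is at the same time bounded by \<open>c\<close> times the norm (\<open>f = 0\<close>) and
  pulled back by \<open>U\<close> to a functional of norm at most \<open>1\<close> (\<open>y = U f\<close>).
\<close>

definition approx_norm :: "real \<Rightarrow> ('i \<Rightarrow> 'b) \<Rightarrow> real" where
  "approx_norm c y = (INF f\<in>carrier X. nrm X f + c * nrm W (y \<ominus>\<^bsub>W\<^esub> U f))"

lemma
  assumes c: "0 \<le> c" and y: "y \<in> carrier W"
  shows approx_norm_le: "f \<in> carrier X \<Longrightarrow> approx_norm c y \<le> nrm X f + c * nrm W (y \<ominus>\<^bsub>W\<^esub> U f)"
    and le_approx_norm: "(\<And>f. f \<in> carrier X \<Longrightarrow> z \<le> nrm X f + c * nrm W (y \<ominus>\<^bsub>W\<^esub> U f)) \<Longrightarrow> z \<le> approx_norm c y"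
proof -
  have "0 \<le> nrm X f + c * nrm W (y \<ominus>\<^bsub>W\<^esub> U f)" if "f \<in> carrier X" for f
    using that c y U_mem by (simp add: X.nrm_nonneg W.nrm_nonneg)
  then have bdd: "bdd_below ((\<lambda>f. nrm X f + c * nrm W (y \<ominus>\<^bsub>W\<^esub> U f)) ` carrier X)"
    by (intro bdd_belowI2) auto
  show "f \<in> carrier X \<Longrightarrow> approx_norm c y \<le> nrm X f + c * nrm W (y \<ominus>\<^bsub>W\<^esub> U f)"
    unfolding approx_norm_def by (rule cINF_lower[OF bdd])
  have "carrier X \<noteq> {}" using X.M.zero_closed by blast
  then show "(\<And>f. f \<in> carrier X \<Longrightarrow> z \<le> nrm X f + c * nrm W (y \<ominus>\<^bsub>W\<^esub> U f)) \<Longrightarrow> z \<le> approx_norm c y"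
    unfolding approx_norm_def by (rule cINF_greatest)
qed

lemma U_zero: "U \<zero>\<^bsub>X\<^esub> = \<zero>\<^bsub>W\<^esub>"
  using nrm_U_le[of "\<zero>\<^bsub>X\<^esub>"] W.nrm_nonneg[OF U_mem, of "\<zero>\<^bsub>X\<^esub>"] W.nrm_eq_zero[OF U_mem, of "\<zero>\<^bsub>X\<^esub>"]
  by simp

lemma W_minus_zero: "y \<in> carrier W \<Longrightarrow> y \<ominus>\<^bsub>W\<^esub> \<zero>\<^bsub>W\<^esub> = y"
proof -
  assume y: "y \<in> carrier W"
  have "\<ominus>\<^bsub>W\<^esub> \<zero>\<^bsub>W\<^esub> = \<zero>\<^bsub>W\<^esub>" by (rule W.M.minus_equality) auto
  then show ?thesis using y by (simp only: W.M.minus_eq W.M.r_zero)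
qed

lemma approx_norm_add:
  assumes c: "0 \<le> c" and y: "y \<in> carrier W" and z: "z \<in> carrier W"
  shows "approx_norm c (y \<oplus>\<^bsub>W\<^esub> z) \<le> approx_norm c y + approx_norm c z"
proof -
  have "approx_norm c (y \<oplus>\<^bsub>W\<^esub> z) \<le>
      (nrm X f + c * nrm W (y \<ominus>\<^bsub>W\<^esub> U f)) + (nrm X h + c * nrm W (z \<ominus>\<^bsub>W\<^esub> U h))"
    if f: "f \<in> carrier X" and h: "h \<in> carrier X" for f h
  proof -
    have "(y \<oplus>\<^bsub>W\<^esub> z) \<ominus>\<^bsub>W\<^esub> U (f \<oplus>\<^bsub>X\<^esub> h) = (y \<ominus>\<^bsub>W\<^esub> U f) \<oplus>\<^bsub>W\<^esub> (z \<ominus>\<^bsub>W\<^esub> U h)"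
      using y z U_mem[OF f] U_mem[OF h]
      by (simp add: U_add f h W.M.minus_eq W.M.minus_add W.M.a_ac)
    then have "nrm W ((y \<oplus>\<^bsub>W\<^esub> z) \<ominus>\<^bsub>W\<^esub> U (f \<oplus>\<^bsub>X\<^esub> h)) \<le> nrm W (y \<ominus>\<^bsub>W\<^esub> U f) + nrm W (z \<ominus>\<^bsub>W\<^esub> U h)"
      using W.nrm_triangle y z U_mem[OF f] U_mem[OF h] by simp
    from mult_left_mono[OF this c]
    have "c * nrm W ((y \<oplus>\<^bsub>W\<^esub> z) \<ominus>\<^bsub>W\<^esub> U (f \<oplus>\<^bsub>X\<^esub> h)) \<le> c * nrm W (y \<ominus>\<^bsub>W\<^esub> U f) + c * nrm W (z \<ominus>\<^bsub>W\<^esub> U h)"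
      by (simp add: distrib_left)
    moreover have "approx_norm c (y \<oplus>\<^bsub>W\<^esub> z) \<le>
        nrm X (f \<oplus>\<^bsub>X\<^esub> h) + c * nrm W ((y \<oplus>\<^bsub>W\<^esub> z) \<ominus>\<^bsub>W\<^esub> U (f \<oplus>\<^bsub>X\<^esub> h))"
      using y z f h by (intro approx_norm_le c) auto
    ultimately show ?thesis using X.nrm_triangle[OF f h] by linarith
  qed
  then have "approx_norm c (y \<oplus>\<^bsub>W\<^esub> z) - (nrm X f + c * nrm W (y \<ominus>\<^bsub>W\<^esub> U f)) \<le> approx_norm c z"
    if "f \<in> carrier X" for f
    using that by (intro le_approx_norm c z) (smt (verit))
  then have "approx_norm c (y \<oplus>\<^bsub>W\<^esub> z) - approx_norm c z \<le> approx_norm c y"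
    by (intro le_approx_norm c y) (smt (verit))
  then show ?thesis by simp
qed

lemma approx_norm_le_nrm: "\<lbrakk>0 \<le> c; y \<in> carrier W\<rbrakk> \<Longrightarrow> approx_norm c y \<le> c * nrm W y"
  using approx_norm_le[of c y "\<zero>\<^bsub>X\<^esub>"] by (simp add: U_zero W_minus_zero)

lemma approx_norm_U_le: "\<lbrakk>0 \<le> c; f \<in> carrier X\<rbrakk> \<Longrightarrow> approx_norm c (U f) \<le> nrm X f"
  using approx_norm_le[OF _ U_mem, of c f f] U_mem[of f] by (simp add: W.M.minus_eq W.M.r_neg)

lemma approx_norm_nonneg: "\<lbrakk>0 \<le> c; y \<in> carrier W\<rbrakk> \<Longrightarrow> 0 \<le> approx_norm c y"
  by (intro le_approx_norm) (simp_all add: X.nrm_nonneg W.nrm_nonneg U_mem)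

lemma approx_norm_smult_le:
  assumes c: "0 \<le> c" and y: "y \<in> carrier W" and k: "k \<in> K"
  shows "approx_norm c (k \<odot>\<^bsub>W\<^esub> y) \<le> norm k * approx_norm c y"
proof (cases "k = 0")
  case True
  have "approx_norm c \<zero>\<^bsub>W\<^esub> \<le> 0" using approx_norm_le_nrm[OF c, of "\<zero>\<^bsub>W\<^esub>"] by simp
  then show ?thesis using True y by (simp add: W.K_smult(5))
next
  case False
  have ky: "k \<odot>\<^bsub>W\<^esub> y \<in> carrier W" by (rule W.K_smult(1)[OF y k])
  have "approx_norm c (k \<odot>\<^bsub>W\<^esub> y) / norm k \<le> nrm X f + c * nrm W (y \<ominus>\<^bsub>W\<^esub> U f)"
    if f: "f \<in> carrier X" for f
  proof -
    have kf: "k \<odot>\<^bsub>X\<^esub> f \<in> carrier X" by (rule X.K_smult(1)[OF f k])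
    have "k \<odot>\<^bsub>W\<^esub> y \<ominus>\<^bsub>W\<^esub> U (k \<odot>\<^bsub>X\<^esub> f) = k \<odot>\<^bsub>W\<^esub> (y \<ominus>\<^bsub>W\<^esub> U f)"
      using y U_mem[OF f] k W.smult_r_minus[of k "U f"] U_smult[OF k f]
      by (simp add: W.M.minus_eq W.K_smult_add) (simp add: scalar_field_def)
    moreover have "nrm W (k \<odot>\<^bsub>W\<^esub> (y \<ominus>\<^bsub>W\<^esub> U f)) = norm k * nrm W (y \<ominus>\<^bsub>W\<^esub> U f)"
      using y U_mem[OF f] k by (intro W.nrm_smult) auto
    ultimately have "approx_norm c (k \<odot>\<^bsub>W\<^esub> y) \<le> norm k * (nrm X f + c * nrm W (y \<ominus>\<^bsub>W\<^esub> U f))"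
      using approx_norm_le[OF c ky kf] X.nrm_smult[OF k f] by (simp add: algebra_simps)
    then show ?thesis using False by (simp add: field_simps)
  qed
  then have "approx_norm c (k \<odot>\<^bsub>W\<^esub> y) / norm k \<le> approx_norm c y"
    by (rule le_approx_norm[OF c y])
  then show ?thesis using False by (simp add: field_simps)
qed

lemma approx_norm_smult:
  assumes c: "0 \<le> c" and y: "y \<in> carrier W" and k: "k \<in> K"
  shows "approx_norm c (k \<odot>\<^bsub>W\<^esub> y) = norm k * approx_norm c y"
proof (rule antisym)
  show "norm k * approx_norm c y \<le> approx_norm c (k \<odot>\<^bsub>W\<^esub> y)"
  proof (cases "k = 0")
    case True
    then show ?thesis using approx_norm_nonneg[OF c W.K_smult(1)[OF y k]] by simp
  next
    case False
    have inv: "inverse k \<in> K" using k scalars by auto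
    have "approx_norm c (inverse k \<odot>\<^bsub>W\<^esub> (k \<odot>\<^bsub>W\<^esub> y)) \<le> norm (inverse k) * approx_norm c (k \<odot>\<^bsub>W\<^esub> y)"
      by (rule approx_norm_smult_le[OF c W.K_smult(1)[OF y k] inv])
    moreover have "inverse k \<odot>\<^bsub>W\<^esub> (k \<odot>\<^bsub>W\<^esub> y) = y"
      using False y by (simp add: W.K_smult(3)[OF y inv k, symmetric] W.K_smult(4))
    ultimately show ?thesis using False by (simp add: norm_divide field_simps)
  qed
qed (rule approx_norm_smult_le[OF assms])

text \<open>
  The bound is independent of \<open>c\<close>. Letting \<open>c\<close> be large, it says that \<open>y\<close> is almost the image of a
  vector of norm at most \<open>\<parallel>y\<parallel> / A\<close>.
\<close>

lemma approx_norm_bound: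
  assumes c: "0 \<le> c" and y: "y \<in> carrier W"
  shows "approx_norm c y \<le> nrm W y / A"
proof -
  obtain \<phi> where \<phi>: "linear_map K W (scalar_field K) \<phi>"
    "\<And>z. z \<in> carrier W \<Longrightarrow> norm (\<phi> z) \<le> approx_norm c z" "\<phi> y = of_real (approx_norm c y)"
    using W.Hahn_Banach[of "approx_norm c" y, OF approx_norm_add[OF c] approx_norm_smult[OF c] y] by blast
  have "norm (\<phi> y) \<le> nrm W y / A"
  proof (rule functional_bound[OF \<phi>(1) _ c _ y])
    show "norm (\<phi> z) \<le> c * nrm W z" if "z \<in> carrier W" for z
      using \<phi>(2)[OF that] approx_norm_le_nrm[OF c that] by simp
    show "norm (\<phi> (U f)) \<le> nrm X f" if "f \<in> carrier X" for f
      using \<phi>(2)[OF U_mem[OF that]] approx_norm_U_le[OF c that] by simp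
  qed
  then show ?thesis using \<phi>(3) by simp
qed

lemma analysis_lower:
  assumes x: "x \<in> carrier X"
  shows "A * nrm X x \<le> nrm W (U x)"
proof (rule bounded_below_if_approx[OF X scalars normed_W U_linear A nrm_U_le _ _ x])
  show "z = \<zero>\<^bsub>X\<^esub>" if z: "z \<in> carrier X" "U z = \<zero>\<^bsub>W\<^esub>" for z
  proof (rule T_inj[OF z(1)])
    fix i assume "i \<in> I"
    then show "T i z = \<zero>\<^bsub>Y i\<^esub>" using fun_cong[OF z(2), of i] by (simp add: U_def W_simps(4))
  qed
  fix z and c \<epsilon> :: real assume z: "z \<in> carrier X" and c: "0 < c" and \<epsilon>: "0 < \<epsilon>"
  show "\<exists>f\<in>carrier X. nrm X f + c * nrm W (U z \<ominus>\<^bsub>W\<^esub> U f) \<le> nrm W (U z) / A + \<epsilon>"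
  proof (rule ccontr)
    assume "\<not> ?thesis"
    then have "nrm W (U z) / A + \<epsilon> \<le> approx_norm c (U z)"
      using c by (intro le_approx_norm U_mem z) (auto simp: not_le less_imp_le)
    with approx_norm_bound[OF _ U_mem[OF z], of c] c \<epsilon> show False by simp
  qed
qed

end

section \<open>Riesz bases are fusion frames\<close>

theorem mainTheorem6:
  fixes K :: "complex set"
    and p q A B :: real
    and I :: "nat set"
    and X :: "(complex, 'a) normed_module"
    and Y :: "nat \<Rightarrow> (complex, 'b) normed_module"
    and V :: "nat \<Rightarrow> 'a set"
    and P :: "nat \<Rightarrow> 'a \<Rightarrow> 'a"
    and L :: "nat \<Rightarrow> 'a \<Rightarrow> 'b"
    and v :: "nat \<Rightarrow> real"
  assumes "K = \<real> \<or> K = UNIV"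
    and "1 < p" and "1 < q" and "1 / p + 1 / q = 1"
    and "banach_space K X" and "separable_space (nrm_topology X)"
    and "\<And>i. i \<in> I \<Longrightarrow> banach_space K (Y i)"
    and "gf_riesz_basis q K I X Y V P L v A B"
  shows "g_fusion_frame p K I X Y V P L v A B"
proof -
  \<comment> \<open>The weights are absorbed into the operators.\<close>
  define T where "T i f = of_real (v i) \<odot>\<^bsub>Y i\<^esub> L i (P i f)" for i f
  have fam: "fusion_family K I X Y V P L v"
    and ker: "{f \<in> carrier X. \<forall>i\<in>I. L i (P i f) = \<zero>\<^bsub>Y i\<^esub>} = {\<zero>\<^bsub>X\<^esub>}"
    and AB: "0 < A" "A \<le> B"
    and riesz: "\<And>J g. \<lbrakk>finite J; J \<subseteq> I; \<And>i. i \<in> J \<Longrightarrow> g i \<in> dual K (Y i)\<rbrakk> \<Longrightarrow>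
        (\<lambda>f. \<Sum>i\<in>J. of_real (v i) * g i (L i (P i f))) \<in> dual K X \<and>
        A * lnorm q J (\<lambda>i. dual_norm (Y i) (g i))
          \<le> dual_norm X (\<lambda>f. \<Sum>i\<in>J. of_real (v i) * g i (L i (P i f))) \<and>
        dual_norm X (\<lambda>f. \<Sum>i\<in>J. of_real (v i) * g i (L i (P i f)))
          \<le> B * lnorm q J (\<lambda>i. dual_norm (Y i) (g i))"
    using assms(8) unfolding gf_riesz_basis_def lnorm_def by auto
  have Y: "normed_vector_space K (Y i)" if "i \<in> I" for i
    by (intro normed_vector_space.intro normed_vector_space_axioms.intro assms(1)
        banach_space.axioms(1)[OF assms(7)[OF that]])
  have v: "0 < v i" and LP: "linear_map K X (Y i) (\<lambda>f. L i (P i f))" if "i \<in> I" for i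
    using fam that
    by (auto simp: fusion_family_def linear_projection_def bounded_operators_def linear_map_def Pi_iff)
  have LP_closed: "L i (P i f) \<in> carrier (Y i)" if "i \<in> I" "f \<in> carrier X" for i f
    using LP[OF that(1)] that(2) by (auto simp: linear_map_def)
  have T: "linear_map K X (Y i) (T i)" if i: "i \<in> I" for i
  proof -
    interpret Yi: normed_vector_space K "Y i" by (rule Y[OF i])
    show ?thesis
      using LP[OF i] LP_closed[OF i] unfolding T_def linear_map_def
      by (auto simp: Yi.K_smult(1) Yi.K_smult_add mult.commute simp flip: Yi.K_smult(3))
  qed
  have nrm_T: "nrm (Y i) (T i f) = v i * nrm (Y i) (L i (P i f))" if i: "i \<in> I" and f: "f \<in> carrier X" for i f
  proof -
    interpret Yi: normed_vector_space K "Y i" by (rule Y[OF i])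
    show ?thesis
      using v[OF i] Yi.nrm_smult[OF Yi.of_real_K LP_closed[OF i f], of "v i"] by (simp add: T_def)
  qed
  have T_zero: "L i (P i f) = \<zero>\<^bsub>Y i\<^esub>" if "i \<in> I" "f \<in> carrier X" "T i f = \<zero>\<^bsub>Y i\<^esub>" for i f
  proof -
    interpret Yi: normed_vector_space K "Y i" by (rule Y[OF that(1)])
    show ?thesis
      using nrm_T[OF that(1,2)] that(3) v[OF that(1)] Yi.nrm_eq_zero[OF LP_closed[OF that(1,2)]] by simp
  qed
  have g_T: "g (T i f) = of_real (v i) * g (L i (P i f))"
    if "i \<in> I" "g \<in> dual K (Y i)" "f \<in> carrier X" for i g f
  proof -
    interpret Yi: normed_vector_space K "Y i" by (rule Y[OF that(1)])
    show ?thesis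
      unfolding T_def by (rule Yi.dual_D(2)[OF that(2) Yi.of_real_K LP_closed[OF that(1,3)]])
  qed
  have sum_T: "(\<Sum>i\<in>J. of_real (v i) * g i (L i (P i f))) = (\<Sum>i\<in>J. g i (T i f))"
    if "J \<subseteq> I" "\<And>i. i \<in> J \<Longrightarrow> g i \<in> dual K (Y i)" "f \<in> carrier X" for J g f
    using that g_T by (intro sum.cong) auto
  interpret X: normed_space K X by (rule banach_space.axioms(1)[OF assms(5)])
  interpret vs: Module.module "scalar_field K" X by (rule X.vector_space)
  have dual_cong: "g \<in> dual K X \<longleftrightarrow> h \<in> dual K X" "dual_norm X g = dual_norm X h"
    if "\<And>f. f \<in> carrier X \<Longrightarrow> g f = h f" for g h
  proof -
    show "dual_norm X g = dual_norm X h"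
      unfolding dual_norm_def using that by (intro arg_cong[where f=Sup] image_cong) auto
    have "c \<odot>\<^bsub>X\<^esub> x \<in> carrier X" if "c \<in> K" "x \<in> carrier X" for c x
      using vs.smult_closed[of c x] that by (simp add: scalar_field_def)
    then show "g \<in> dual K X \<longleftrightarrow> h \<in> dual K X"
      using that by (simp add: dual_def bounded_operators_def linear_map_def Pi_iff)
  qed
  interpret riesz_family K p q I Y X T A B
  proof (intro riesz_family.intro lp_family.intro riesz_family_axioms.intro assms(1-5) AB Y T)
    show "x = \<zero>\<^bsub>X\<^esub>" if "x \<in> carrier X" "\<And>i. i \<in> I \<Longrightarrow> T i x = \<zero>\<^bsub>Y i\<^esub>" for x
      using that T_zero ker by blast
    fix J and g :: "nat \<Rightarrow> 'b \<Rightarrow> complex"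
    assume J: "finite J" "J \<subseteq> I" and g: "\<And>i. i \<in> J \<Longrightarrow> g i \<in> dual K (Y i)"
    have sum_eq: "(\<Sum>i\<in>J. of_real (v i) * g i (L i (P i f))) = (\<Sum>i\<in>J. g i (T i f))"
      if "f \<in> carrier X" for f
      by (rule sum_T[OF J(2) g that])
    note eq = dual_cong[OF sum_eq]
    show "(\<lambda>f. \<Sum>i\<in>J. g i (T i f)) \<in> dual K X"
      by (rule iffD1[OF eq(1) conjunct1[OF riesz[OF J g]]])
    show "A * lnorm q J (\<lambda>i. dual_norm (Y i) (g i)) \<le> dual_norm X (\<lambda>f. \<Sum>i\<in>J. g i (T i f))"
      by (rule ord_le_eq_trans[OF conjunct1[OF conjunct2[OF riesz[OF J g]]] eq(2)])
    show "dual_norm X (\<lambda>f. \<Sum>i\<in>J. g i (T i f)) \<le> B * lnorm q J (\<lambda>i. dual_norm (Y i) (g i))"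
      by (rule ord_eq_le_trans[OF eq(2)[symmetric] conjunct2[OF conjunct2[OF riesz[OF J g]]]])
  qed
  show ?thesis
    unfolding g_fusion_frame_def
  proof (intro conjI ballI fam A AB)
    fix f assume f: "f \<in> carrier X"
    have eq: "nrm (Y i) (U f i) powr p = v i powr p * nrm (Y i) (L i (P i f)) powr p" if "i \<in> I" for i
      using that by (simp add: U_def nrm_T[OF that f] powr_mult)
    have "(\<lambda>i. nrm (Y i) (U f i) powr p) summable_on I \<longleftrightarrow>
        (\<lambda>i. v i powr p * nrm (Y i) (L i (P i f)) powr p) summable_on I"
      by (rule summable_on_cong) (rule eq)
    then show "(\<lambda>i. v i powr p * nrm (Y i) (L i (P i f)) powr p) summable_on I"
      using U_mem[OF f] by (simp add: W_simps(1))
    have "(\<Sum>\<^sub>\<infinity>i\<in>I. nrm (Y i) (U f i) powr p) = (\<Sum>\<^sub>\<infinity>i\<in>I. v i powr p * nrm (Y i) (L i (P i f)) powr p)"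
      by (rule infsum_cong) (rule eq)
    then have "nrm (lp_sum p I Y) (U f) =
        (\<Sum>\<^sub>\<infinity>i\<in>I. v i powr p * nrm (Y i) (L i (P i f)) powr p) powr (1 / p)"
      by (simp only: W_simps(5))
    then show "A * nrm X f \<le> (\<Sum>\<^sub>\<infinity>i\<in>I. v i powr p * nrm (Y i) (L i (P i f)) powr p) powr (1 / p)"
      "(\<Sum>\<^sub>\<infinity>i\<in>I. v i powr p * nrm (Y i) (L i (P i f)) powr p) powr (1 / p) \<le> B * nrm X f"
      using analysis_lower[OF f] nrm_U_le[OF f] by simp_all
  qed
qed

end
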